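(* Let $u \in H^\infty(\mathbb{D})$ be a nonconstant inner function, and let $\varphi \in L^\infty(\mathbb{T})$. Then the following are equivalent: (1) $u H^2$ is invariant under $H_\varphi$. (2) $u H^2 \subseteq \ker H_\varphi$. (3) $P_+\varphi \in \mathcal{Q}_{\overline{Ju}}$.
   Context: $\mathbb{T}$ is the unit circle and $\mathbb{D}$ the open unit disc. $H^2\subseteq L^2(\mathbb{T})$ is the Hardy space (functions whose negative Fourier coefficients vanish), $P_+$ is the orthogonal projection of $L^2(\mathbb{T})$ onto $H^2$, and $J:L^2(\mathbb{T})\to L^2(\mathbb{T})$ is the unitary $(Jf)(z)=f(\bar z)$. For $\varphi\in L^\infty(\mathbb{T})$, the Hankel operator $H_\varphi$ on $H^2$ is $H_\varphi f=P_+(\varphi\, Jf)$. $H^\infty(\mathbb{D})$ is the algebra of bounded analytic functions on $\mathbb{D}$; $u\in H^\infty(\mathbb{D})$ is inner if its radial limits satisfy $|u|=1$ a.e. on $\mathbb{T}$. For an inner function $v$, $\mathcal{Q}_v=H^2\ominus vH^2$ is the model space. For $u=\sum_{n\ge 0}a_nz^n$ one has $\overline{Ju}=\sum_{n\ge0}\bar a_nz^n$, which is inner when $u$ is inner. *)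

theory Defs
  imports "HOL-Complex_Analysis.Complex_Analysis"
begin

text \<open>
  Elements of \<open>L\<^sup>2\<close> and \<open>L\<^sup>\<infinity>\<close> of the unit circle are represented by Borel functions; two functions
  represent the same element iff they agree almost everywhere. All sets of functions below are
  closed under almost everywhere equality of Borel functions on the circle.
\<close>

definition circle :: "complex measure" where
  "circle = distr (uniform_measure lborel {0..<2 * pi}) (restrict_space borel (sphere 0 1)) cis"

definition L2_circle :: "(complex \<Rightarrow> complex) set" where
  "L2_circle = {f \<in> borel_measurable circle. integrable circle (\<lambda>z. (norm (f z))\<^sup>2)}"

definition Linf_circle :: "(complex \<Rightarrow> complex) set" where
  "Linf_circle = {f \<in> borel_measurable circle. \<exists>C. AE z in circle. norm (f z) \<le> C}"

definition L2_inner :: "(complex \<Rightarrow> complex) \<Rightarrow> (complex \<Rightarrow> complex) \<Rightarrow> complex" where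
  "L2_inner f g = (LINT z|circle. f z * cnj (g z))"

definition fourier_coeff :: "(complex \<Rightarrow> complex) \<Rightarrow> int \<Rightarrow> complex" where
  "fourier_coeff f n = (LINT z|circle. f z * cnj (z powi n))"

definition Hardy2 :: "(complex \<Rightarrow> complex) set" where
  "Hardy2 = {f \<in> L2_circle. \<forall>n<0. fourier_coeff f n = 0}"

text \<open>
  For \<open>f\<close> in \<open>L\<^sup>2\<close>, the conditions determine the projection of \<open>f\<close> up to almost everywhere equality;
  \<open>P_plus f\<close> is some representative of it.
\<close>

definition P_plus :: "(complex \<Rightarrow> complex) \<Rightarrow> (complex \<Rightarrow> complex)" where
  "P_plus f = (SOME g. g \<in> Hardy2 \<and> (\<forall>h\<in>Hardy2. L2_inner (\<lambda>z. f z - g z) h = 0))"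

definition J_flip :: "(complex \<Rightarrow> complex) \<Rightarrow> (complex \<Rightarrow> complex)" where
  "J_flip f = (\<lambda>z. f (cnj z))"

definition Hankel :: "(complex \<Rightarrow> complex) \<Rightarrow> (complex \<Rightarrow> complex) \<Rightarrow> (complex \<Rightarrow> complex)" where
  "Hankel \<phi> f = P_plus (\<lambda>z. \<phi> z * J_flip f z)"

definition ker_Hankel :: "(complex \<Rightarrow> complex) \<Rightarrow> (complex \<Rightarrow> complex) set" where
  "ker_Hankel \<phi> = {f \<in> Hardy2. AE z in circle. Hankel \<phi> f z = 0}"

definition Hinf_disc :: "(complex \<Rightarrow> complex) set" where
  "Hinf_disc = {u. u holomorphic_on ball 0 1 \<and> bounded (u ` ball 0 1)}"

text \<open>The value of \<open>radial_limit\<close> is unspecified where the limit does not exist.\<close>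

definition radial_limit :: "(complex \<Rightarrow> complex) \<Rightarrow> complex \<Rightarrow> complex" where
  "radial_limit u z = Lim (at_left (1::real)) (\<lambda>r. u (of_real r * z))"

definition inner_function :: "(complex \<Rightarrow> complex) \<Rightarrow> bool" where
  "inner_function u \<longleftrightarrow> u \<in> Hinf_disc \<and>
     (AE z in circle. ((\<lambda>r. u (of_real r * z)) \<longlongrightarrow> radial_limit u z) (at_left (1::real))
        \<and> norm (radial_limit u z) = 1)"

text \<open>
  In the following two definitions \<open>v\<close> is a function on the circle; an inner function on the disc
  enters through its radial limits.
\<close>

definition mult_Hardy2 :: "(complex \<Rightarrow> complex) \<Rightarrow> (complex \<Rightarrow> complex) set" where
  "mult_Hardy2 v = {f \<in> L2_circle. \<exists>h\<in>Hardy2. AE z in circle. f z = v z * h z}"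

definition model_space :: "(complex \<Rightarrow> complex) \<Rightarrow> (complex \<Rightarrow> complex) set" where
  "model_space v = {f \<in> Hardy2. \<forall>g\<in>mult_Hardy2 v. L2_inner f g = 0}"

end

theory Submission
  imports Defs "HOL-Probability.Probability_Measure"
begin

text \<open>
  Everything is read off from Fourier coefficients. For \<open>n \<ge> 0\<close> the \<open>n\<close>-th coefficient of the image of
  \<open>f\<close> under the Hankel operator is that of \<open>\<phi> * J f\<close>, and on the circle \<open>J (z * f) = J f / z\<close>; so
  multiplying \<open>f\<close> by \<open>z\<close> replaces the image by its backward shift
  (\<open>fourier_coeff_Hankel_powi\<close>).

  Invariance implies inclusion in the kernel. Let \<open>g\<close> be the image of some \<open>f\<close> in \<open>u * H\<^sup>2\<close>
  and \<open>g'\<close> the image of \<open>z * f\<close>, both in \<open>u * H\<^sup>2\<close>. Then the mean \<open>c = g - z * g'\<close> of \<open>g\<close> is a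
  multiple \<open>u * w\<close> with \<open>w\<close> in \<open>H\<^sup>2\<close>. If \<open>c \<noteq> 0\<close>, then \<open>cnj u = w / c\<close> lies in \<open>H\<^sup>2\<close> together
  with \<open>u\<close>, and \<open>u\<close> is constant. So all images have mean zero (\<open>invariant_imp_mean_zero\<close>); applied to
  \<open>z ^ n * f\<close> this kills every coefficient of \<open>g\<close>. The converse holds because 0 lies in
  \<open>u * H\<^sup>2\<close>.

  Inclusion in the kernel is thus the vanishing of the mean of \<open>\<phi> * J f\<close> for all \<open>f\<close> in
  \<open>u * H\<^sup>2\<close> (\<open>mult_Hardy2_subset_ker_iff\<close>). This mean is the inner product of \<open>\<phi>\<close> with \<open>cnj (J f)\<close>, and
  \<open>f \<mapsto> cnj (J f)\<close> maps \<open>u * H\<^sup>2\<close> onto \<open>cnj (J u) * H\<^sup>2\<close>, a subspace of \<open>H\<^sup>2\<close>; there \<open>\<phi>\<close> may be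
  replaced by its projection (\<open>subset_ker_iff_model_space\<close>).

  The analysis behind this consists of three facts. A function with vanishing Fourier
  coefficients is null (\<open>fourier_null_imp_AE_zero\<close>). The projection onto \<open>H\<^sup>2\<close> exists and is the
  limit of partial sums, which rests on completeness of \<open>L\<^sup>2\<close> (\<open>L2_circle_complete\<close>,
  \<open>hardy_sum_converges\<close>, \<open>P_plus_spec\<close>). The Fourier coefficients of the radial limit of \<open>u\<close> are its
  Taylor coefficients (\<open>inner_function_boundary_values\<close>); this puts the radial limit in \<open>H\<^sup>2\<close>
  and shows that it has a positive frequency when \<open>u\<close> is not constant.
\<close>

section \<open>Normalized arc length on the circle\<close>

lemma cis_measurable_sphere: "cis \<in> measurable borel (restrict_space borel (sphere 0 1))"
proof (rule measurable_restrict_space2)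
  show "cis \<in> borel_measurable borel"
    by (intro borel_measurable_continuous_onI continuous_intros)
qed auto

lemma cis_measurable_uniform:
  "cis \<in> measurable (uniform_measure lborel {0..<2*pi}) (restrict_space borel (sphere 0 1))"
  using cis_measurable_sphere by (simp add: measurable_def)

lemma space_circle [simp]: "space circle = sphere 0 1"
  by (simp add: circle_def space_restrict_space)

lemma sets_circle: "sets circle = sets (restrict_space borel (sphere 0 1))"
  by (simp add: circle_def)

lemma measurable_circle_iff:
  "f \<in> measurable circle N \<longleftrightarrow> f \<in> measurable (restrict_space borel (sphere 0 1)) N"
  by (simp only: measurable_cong_sets[OF sets_circle refl])

lemma borel_measurable_circle:
  "f \<in> borel_measurable borel \<Longrightarrow> f \<in> borel_measurable circle"
  unfolding measurable_circle_iff by (rule measurable_restrict_space1)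

lemma continuous_measurable_circle:
  "continuous_on (sphere 0 1) f \<Longrightarrow> f \<in> borel_measurable circle"
  unfolding measurable_circle_iff by (rule borel_measurable_continuous_on_restrict)

lemma powi_measurable_circle [measurable]: "(\<lambda>z. z powi n) \<in> borel_measurable circle"
  by (intro continuous_measurable_circle continuous_intros) auto

lemma emeasure_arc: "emeasure lborel {0..<2*pi} = ennreal (2*pi)"
  by simp

lemma prob_space_circle: "prob_space circle"
  unfolding circle_def
  by (intro prob_space.prob_space_distr prob_space_uniform_measure cis_measurable_uniform) auto

interpretation circle: prob_space circle
  by (rule prob_space_circle)

text \<open>
  The closed interval of angles, a null set larger than the half-open one, is the form in which
  the fundamental theorem of calculus applies.
\<close>

lemma circle_integral_eq:
  fixes f :: "complex \<Rightarrow> complex"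
  assumes "f \<in> borel_measurable circle"
  shows "(LINT z|circle. f z) = (LINT t|lborel. indicator {0..2*pi} t *\<^sub>R f (cis t)) / (2*pi)"
proof -
  have f: "f \<in> borel_measurable (restrict_space borel (sphere 0 1))"
    using assms by (simp only: measurable_circle_iff)
  have fc: "(\<lambda>t. f (cis t)) \<in> borel_measurable borel"
    using measurable_compose[OF cis_measurable_sphere f] .
  have U: "uniform_measure lborel {0..<2*pi}
        = density lborel (\<lambda>t. ennreal (indicator {0..<2*pi} t / (2*pi)))"
    unfolding uniform_measure_def
    by (rule density_cong) (auto simp: divide_ennreal divide_ennreal[of 1 "2*pi", simplified] split: split_indicator)
  have "(LINT z|circle. f z) = (LINT t|uniform_measure lborel {0..<2*pi}. f (cis t))"
    unfolding circle_def by (rule integral_distr[OF cis_measurable_uniform f])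
  also have "\<dots> = (LINT t|lborel. (indicator {0..<2*pi} t / (2*pi)) *\<^sub>R f (cis t))"
    unfolding U by (rule integral_density) (use fc in auto)
  also have "\<dots> = (LINT t|lborel. (indicator {0..2*pi} t *\<^sub>R f (cis t)) / (2*pi))"
  proof (rule integral_cong_AE)
    have "AE t in lborel. t \<noteq> 2*pi"
      by (rule AE_lborel_singleton)
    then show "AE t in lborel. (indicator {0..<2*pi} t / (2*pi)) *\<^sub>R f (cis t)
          = (indicator {0..2*pi} t *\<^sub>R f (cis t)) / (2*pi)"
      by eventually_elim (auto split: split_indicator simp: scaleR_conv_of_real)
  qed (use fc in measurable)
  finally show ?thesis by simp
qed

lemma powi_cis: "cis t powi n = cis (of_int n * t)"
  by (simp add: cis_power_int)

lemma integral_powi: "(LINT z|circle. z powi n) = (if n = 0 then 1 else 0)"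
proof (cases "n = 0")
  case True
  then show ?thesis using circle.prob_space by simp
next
  case False
  have "(LINT z|circle. z powi n)
      = (LINT t|lborel. indicator {0..2*pi} t *\<^sub>R cis (of_int n * t)) / (2*pi)"
    by (subst circle_integral_eq) (auto simp: powi_cis)
  also have "(LINT t|lborel. indicator {0..2*pi} t *\<^sub>R cis (of_int n * t))
      = cis (of_int n * (2*pi)) / (\<i> * of_int n) - cis (of_int n * 0) / (\<i> * of_int n)"
  proof (rule integral_FTC_atLeastAtMost)
    fix t :: real
    have "((\<lambda>w. exp (\<i> * of_int n * w) / (\<i> * of_int n)) has_field_derivative
        exp (\<i> * of_int n * of_real t)) (at (of_real t))"
      using False by (auto intro!: derivative_eq_intros)
    from has_vector_derivative_real_field[OF this]
    show "((\<lambda>t. cis (of_int n * t) / (\<i> * of_int n)) has_vector_derivative cis (of_int n * t))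
         (at t within {0..2*pi})"
      by (simp add: cis_conv_exp mult.assoc)
  qed (auto intro!: continuous_intros)
  also have "cis (of_int n * (2*pi)) = 1"
    using cis_multiple_2pi[of "of_int n"] by (simp add: mult_ac)
  finally show ?thesis using False by simp
qed

lemma cnj_measurable_circle: "cnj \<in> measurable circle circle"
  unfolding measurable_cong_sets[OF sets_circle sets_circle]
  by (rule measurable_restrict_space3) (auto intro: borel_measurable_continuous_onI continuous_on_cnj continuous_on_id)

text \<open>
  In the angle, conjugation is \<open>t \<mapsto> 2 * pi - t\<close>. This reflection preserves Lebesgue measure and
  carries \<open>{0<..2 * pi}\<close> onto \<open>{0..<2 * pi}\<close>; the two intervals differ by a null set.
\<close>

lemma distr_circle_cnj: "distr circle circle cnj = circle"
proof -
  note cnj_m = cnj_measurable_circle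
  show ?thesis
  proof (rule measure_eqI)
    fix A assume A': "A \<in> sets (distr circle circle cnj)"
    then have A: "A \<in> sets circle" "A \<in> sets (restrict_space borel (sphere 0 1))"
      by (auto simp: sets_circle)
    define B where "B = {t. cis t \<in> A}"
    have B: "B \<in> sets borel"
      using measurable_sets[OF cis_measurable_sphere A(2)] by (simp add: B_def vimage_def)
    have em: "emeasure circle C = emeasure lborel ({0..<2*pi} \<inter> {t. cis t \<in> C}) / ennreal (2*pi)"
      if C: "C \<in> sets circle" for C
    proof -
      have C': "C \<in> sets (restrict_space borel (sphere 0 1))" using C by (simp add: sets_circle)
      have "{t. cis t \<in> C} \<in> sets borel"
        using measurable_sets[OF cis_measurable_sphere C'] by (simp add: vimage_def)
      then show ?thesis
        unfolding circle_def
        by (subst emeasure_distr[OF cis_measurable_uniform C'])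
           (auto simp: vimage_def emeasure_arc)
    qed
    have "emeasure (distr circle circle cnj) A = emeasure circle (cnj -` A \<inter> sphere 0 1)"
      using A(1) by (simp add: emeasure_distr[OF cnj_m])
    also have "\<dots> = emeasure lborel ({0..<2*pi} \<inter> {t. cis t \<in> cnj -` A \<inter> sphere 0 1}) / ennreal (2*pi)"
      using measurable_sets[OF cnj_m A(1)] by (intro em) auto
    also have "{0..<2*pi} \<inter> {t. cis t \<in> cnj -` A \<inter> sphere 0 1}
        = (\<lambda>t. 2*pi + (-1) * t) -` ({0<..2*pi} \<inter> B) \<inter> space lborel"
    proof -
      have "cis (2*pi - t) = cnj (cis t)" for t
        by (simp add: cis_cnj flip: cis_divide) (simp add: inverse_eq_divide[symmetric])
      then show ?thesis by (auto simp: B_def)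
    qed
    also have "emeasure lborel \<dots> = emeasure (distr lborel borel (\<lambda>t. 2*pi + (-1) * t)) ({0<..2*pi} \<inter> B)"
      using B by (subst emeasure_distr) auto
    also have "distr lborel borel (\<lambda>t. 2*pi + (-1) * t) = lborel"
      using lborel_affine[of "-1" "2*pi"] lborel_real_affine[of "-1" "2*pi"]
      by (simp add: density_1)
    also have "emeasure lborel ({0<..2*pi} \<inter> B) = emeasure lborel ({0..<2*pi} \<inter> B)"
    proof (rule emeasure_eq_AE)
      have "AE t in lborel. t \<noteq> 2*pi" "AE t in lborel. t \<noteq> (0::real)"
        by (rule AE_lborel_singleton)+
      then show "AE t in lborel. (t \<in> {0<..2*pi} \<inter> B) = (t \<in> {0..<2*pi} \<inter> B)"
        by eventually_elim auto
    qed (use B in auto)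
    also have "emeasure lborel ({0..<2*pi} \<inter> B) / ennreal (2*pi) = emeasure circle A"
      using em[OF A(1)] by (simp add: B_def)
    finally show "emeasure (distr circle circle cnj) A = emeasure circle A" .
  qed simp
qed

lemma integral_cnj_flip:
  fixes f :: "complex \<Rightarrow> 'a::{banach, second_countable_topology}"
  assumes "f \<in> borel_measurable circle"
  shows "(LINT z|circle. f (cnj z)) = (LINT z|circle. f z)"
  using integral_distr[OF cnj_measurable_circle assms, unfolded distr_circle_cnj] by (rule sym)

lemma integrable_cnj_flip:
  fixes f :: "complex \<Rightarrow> 'a::{banach, second_countable_topology}"
  assumes "integrable circle f"
  shows "integrable circle (\<lambda>z. f (cnj z))"
  using integrable_distr[OF cnj_measurable_circle, unfolded distr_circle_cnj, OF assms] .

lemma AE_cnj_flip: "AE z in circle. P z \<Longrightarrow> AE z in circle. P (cnj z)"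
  using AE_distrD[OF cnj_measurable_circle, unfolded distr_circle_cnj] .

section \<open>Fourier coefficients and their uniqueness\<close>

lemma integrable_mult_bounded:
  fixes f g :: "complex \<Rightarrow> complex"
  assumes "integrable circle f" "g \<in> borel_measurable circle" "AE z in circle. norm (g z) \<le> C"
  shows "integrable circle (\<lambda>z. f z * g z)"
proof (rule Bochner_Integration.integrable_bound)
  show "integrable circle (\<lambda>z. of_real C * f z)" using assms(1) by simp
  show "AE z in circle. norm (f z * g z) \<le> norm (of_real C * f z)"
    using assms(3)
  proof eventually_elim
    case (elim z)
    then have "norm (f z) * norm (g z) \<le> norm (f z) * \<bar>C\<bar>"
      by (intro mult_left_mono) auto
    then show ?case by (simp add: norm_mult mult.commute)
  qed
qed (use assms in measurable)

lemma norm_powi_circle: "z \<in> sphere 0 1 \<Longrightarrow> norm (z powi n :: complex) = 1"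
  by (simp add: norm_power_int)

lemma AE_circleI: "(\<And>z. norm z = 1 \<Longrightarrow> P z) \<Longrightarrow> AE z in circle. P z"
  by (rule AE_I2) simp

lemma cnj_eq_inverse_circle: "norm z = 1 \<Longrightarrow> cnj z = inverse z"
  by (metis complex_norm_square inverse_unique of_real_1 one_power2)

lemma cnj_powi_circle: "norm z = 1 \<Longrightarrow> cnj z powi n = z powi (- n)"
  by (cases n) (simp_all add: power_int_def cnj_eq_inverse_circle flip: power_inverse)

lemma integrable_mult_powi:
  "integrable circle f \<Longrightarrow> integrable circle (\<lambda>z. f z * z powi n)"
  by (rule integrable_mult_bounded[where C=1]) (auto intro!: AE_circleI simp: norm_powi_circle)

lemma fourier_coeff_eq: "fourier_coeff f n = (LINT z|circle. f z * z powi (- n))"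
  unfolding fourier_coeff_def by (rule Bochner_Integration.integral_cong) (auto simp: cnj_powi_circle)

lemma fourier_coeff_shift:
  "fourier_coeff (\<lambda>z. f z * z powi k) n = fourier_coeff f (n - k)"
  unfolding fourier_coeff_eq
proof (rule Bochner_Integration.integral_cong)
  fix z assume "z \<in> space circle"
  then have "z \<noteq> 0" by auto
  then have "z powi k * z powi (- n) = z powi (- (n - k))"
    by (simp flip: power_int_add)
  then show "f z * z powi k * z powi (- n) = f z * z powi (- (n - k))" by (simp add: mult.assoc)
qed simp

lemma fourier_coeff_add:
  assumes "integrable circle f" "integrable circle g"
  shows "fourier_coeff (\<lambda>z. f z + g z) n = fourier_coeff f n + fourier_coeff g n"
  using integrable_mult_powi[OF assms(1), of "-n"] integrable_mult_powi[OF assms(2), of "-n"]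
  by (simp add: fourier_coeff_eq ring_distribs)

lemma fourier_coeff_diff:
  assumes "integrable circle f" "integrable circle g"
  shows "fourier_coeff (\<lambda>z. f z - g z) n = fourier_coeff f n - fourier_coeff g n"
  using integrable_mult_powi[OF assms(1), of "-n"] integrable_mult_powi[OF assms(2), of "-n"]
  by (simp add: fourier_coeff_eq ring_distribs)

lemma fourier_coeff_cmult: "fourier_coeff (\<lambda>z. c * f z) n = c * fourier_coeff f n"
  by (simp add: fourier_coeff_eq mult.assoc)

lemma fourier_coeff_powi: "fourier_coeff (\<lambda>z. z powi k) n = (if n = k then 1 else 0)"
  using fourier_coeff_shift[of "\<lambda>z. 1" k n] integral_powi[of "k - n"]
  by (simp add: fourier_coeff_eq)

lemma fourier_coeff_cong_AE:
  assumes "f \<in> borel_measurable circle" "g \<in> borel_measurable circle" "AE z in circle. f z = g z"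
  shows "fourier_coeff f n = fourier_coeff g n"
  unfolding fourier_coeff_eq
  by (rule integral_cong_AE) (use assms in \<open>measurable, auto\<close>)

text \<open>
  The class of these functions is stable under multiplication by \<open>z\<close> and \<open>1 / z\<close>, hence by
  polynomials in the coordinates. Quantifying over the whole class lets an induction over a polynomial
  treat a product \<open>p * q\<close> as multiplication by \<open>p\<close> followed by multiplication by \<open>q\<close>. That such a
  function vanishes almost everywhere is the completeness of the trigonometric system.
\<close>

definition fourier_null :: "(complex \<Rightarrow> complex) \<Rightarrow> bool" where
  "fourier_null F \<longleftrightarrow> integrable circle F \<and> (\<forall>n. fourier_coeff F n = 0)"

lemma fourier_null_add: "fourier_null F \<Longrightarrow> fourier_null G \<Longrightarrow> fourier_null (\<lambda>z. F z + G z)"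
  by (simp add: fourier_null_def fourier_coeff_add)

lemma fourier_null_cmult: "fourier_null F \<Longrightarrow> fourier_null (\<lambda>z. c * F z)"
  by (simp add: fourier_null_def fourier_coeff_cmult)

lemma fourier_null_shift: "fourier_null F \<Longrightarrow> fourier_null (\<lambda>z. F z * z powi k)"
  by (simp add: fourier_null_def fourier_coeff_shift integrable_mult_powi)

lemma fourier_null_cong:
  assumes "fourier_null F" "\<And>z. norm z = 1 \<Longrightarrow> F z = G z"
  shows "fourier_null G"
proof -
  have "integrable circle F = integrable circle G" "fourier_coeff F = fourier_coeff G"
    using assms(2) unfolding fourier_coeff_def fun_eq_iff
    by (auto intro!: Bochner_Integration.integral_cong Bochner_Integration.integrable_cong)
  then show ?thesis using assms(1) by (simp add: fourier_null_def)
qed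

text \<open>
  A real-linear function of \<open>z\<close> is a combination of \<open>z\<close> and \<open>cnj z\<close>, and \<open>cnj z = 1 / z\<close> on the circle,
  so it only shifts and combines Fourier coefficients.
\<close>

lemma fourier_null_mult_polynomial:
  fixes p :: "complex \<Rightarrow> real"
  assumes "real_polynomial_function p" "fourier_null F"
  shows "fourier_null (\<lambda>z. F z * of_real (p z))"
  using assms
proof (induction p arbitrary: F rule: real_polynomial_function.induct)
  case (linear f)
  interpret f: bounded_linear f by fact
  define a b where "a = f 1" and "b = f \<i>"
  have f: "f z = Re z * a + Im z * b" for z
  proof -
    have "f z = f (Re z *\<^sub>R 1 + Im z *\<^sub>R \<i>)"
      by (rule arg_cong[of _ _ f]) (simp add: complex_eq_iff)
    then show ?thesis by (simp add: f.add f.scaleR a_def b_def)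
  qed
  \<comment> \<open>The coefficients come from \<open>Re z = (z + cnj z) / 2\<close> and \<open>Im z = (z - cnj z) / (2 * \<i>)\<close>.\<close>
  have "fourier_null (\<lambda>z. (of_real a / 2 + of_real b / (2*\<i>)) * (F z * z powi 1)
      + (of_real a / 2 - of_real b / (2*\<i>)) * (F z * z powi (-1)))"
    by (intro fourier_null_add fourier_null_cmult fourier_null_shift linear.prems)
  then show ?case
  proof (rule fourier_null_cong)
    fix z :: complex assume z: "norm z = 1"
    have "(of_real a / 2 + of_real b / (2*\<i>)) * z + (of_real a / 2 - of_real b / (2*\<i>)) * cnj z = of_real (f z)"
      by (simp add: complex_eq_iff f field_simps)
    moreover have "z powi 1 = z" "z powi (-1) = cnj z" using z by (simp_all add: cnj_eq_inverse_circle power_int_def)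
    moreover have "a * (G * x) + b * (G * y) = G * (a * x + b * y)" for a b G x y :: complex
      by (simp add: algebra_simps)
    ultimately show "(of_real a / 2 + of_real b / (2*\<i>)) * (F z * z powi 1)
      + (of_real a / 2 - of_real b / (2*\<i>)) * (F z * z powi (-1)) = F z * of_real (f z)"
      by (simp only:)
  qed
next
  case (const c)
  then show ?case using fourier_null_cmult[of F "of_real c"] by (simp add: mult.commute)
next
  case (add f g)
  then show ?case using fourier_null_add[of "\<lambda>z. F z * of_real (f z)" "\<lambda>z. F z * of_real (g z)"]
    by (simp add: ring_distribs)
next
  case (mult f g)
  then show ?case by (simp add: mult.assoc[symmetric])
qed

text \<open>
  Polynomials in the coordinates are uniformly dense in the continuous functions on the circle.
\<close>

lemma fourier_null_integral_continuous:
  fixes g :: "complex \<Rightarrow> real"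
  assumes F: "fourier_null F" and g: "continuous_on (sphere 0 1) g"
  shows "(LINT z|circle. F z * of_real (g z)) = 0"
proof -
  have FI: "integrable circle F" using F by (simp add: fourier_null_def)
  have "\<exists>p. real_polynomial_function p \<and> (\<forall>z\<in>sphere 0 1. \<bar>g z - p z\<bar> < 1 / real (Suc k))" for k
    using Stone_Weierstrass_real_polynomial_function[OF compact_sphere g, of "1 / real (Suc k)"]
    by (metis of_nat_0_less_iff zero_less_Suc zero_less_divide_1_iff)
  then obtain p where p: "\<And>k. real_polynomial_function (p k)"
      "\<And>k z. norm z = 1 \<Longrightarrow> \<bar>g z - p k z\<bar> < 1 / real (Suc k)"
    by (metis dist_0_norm mem_sphere)
  have gm[measurable]: "g \<in> borel_measurable circle"
    by (rule continuous_measurable_circle[OF g])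
  have pm[measurable]: "p k \<in> borel_measurable circle" for k
    using p(1) continuous_real_polymonial_function continuous_at_imp_continuous_on
    by (intro continuous_measurable_circle) blast
  have Fm[measurable]: "F \<in> borel_measurable circle" using FI by auto
  obtain M where M: "\<And>z. norm z = 1 \<Longrightarrow> \<bar>g z\<bar> \<le> M"
    using compact_imp_bounded[OF compact_continuous_image[OF g compact_sphere]]
    unfolding bounded_iff by (metis dist_0_norm image_eqI mem_sphere real_norm_def)
  have "(\<lambda>k. LINT z|circle. F z * of_real (p k z)) \<longlonglongrightarrow> (LINT z|circle. F z * of_real (g z))"
  proof (rule integral_dominated_convergence)
    show "integrable circle (\<lambda>z. norm (F z) * (M + 1))" using FI by simp
    show "AE z in circle. norm (F z * of_real (p k z)) \<le> norm (F z) * (M + 1)" for k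
    proof (rule AE_circleI)
      fix z :: complex assume z: "norm z = 1"
      have "1 / real (Suc k) \<le> 1" by simp
      then have "\<bar>p k z\<bar> \<le> M + 1" using p(2)[OF z, of k] M[OF z] by linarith
      then show "norm (F z * of_real (p k z)) \<le> norm (F z) * (M + 1)"
        by (simp add: norm_mult mult_left_mono)
    qed
    show "AE z in circle. (\<lambda>k. F z * of_real (p k z)) \<longlonglongrightarrow> F z * of_real (g z)"
    proof (rule AE_circleI)
      fix z :: complex assume z: "norm z = 1"
      have "(\<lambda>k. p k z - g z) \<longlonglongrightarrow> 0"
      proof (rule Lim_null_comparison)
        show "\<forall>\<^sub>F k in sequentially. norm (p k z - g z) \<le> 1 / real (Suc k)"
          using p(2)[OF z] by (intro always_eventually allI) (simp add: abs_minus_commute less_imp_le)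
      qed (rule LIMSEQ_Suc[OF lim_1_over_n])
      then have "(\<lambda>k. p k z) \<longlonglongrightarrow> g z" by (simp add: LIM_zero_iff)
      then show "(\<lambda>k. F z * of_real (p k z)) \<longlonglongrightarrow> F z * of_real (g z)"
        by (intro tendsto_intros)
    qed
  qed measurable
  moreover have "(LINT z|circle. F z * of_real (p k z)) = 0" for k
    using fourier_null_mult_polynomial[OF p(1) F, of k]
    by (auto simp: fourier_null_def fourier_coeff_eq dest: spec[of _ 0])
  ultimately show ?thesis by (simp add: LIMSEQ_const_iff)
qed

text \<open>
  The indicator of a closed set is the bounded pointwise limit of the continuous functions
  \<open>max 0 (1 - k * infdist z C)\<close>.
\<close>

lemma fourier_null_integral_closed:
  assumes F: "fourier_null F" and C: "closed C"
  shows "(LINT z|circle. indicator C z *\<^sub>R F z) = 0"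
proof (cases "C = {}")
  case False
  define g where "g k z = max 0 (1 - real k * infdist z C)" for k :: nat and z :: complex
  have FI: "integrable circle F" using F by (simp add: fourier_null_def)
  have Fm[measurable]: "F \<in> borel_measurable circle" using FI by auto
  have gc: "continuous_on (sphere 0 1) (g k)" for k
    unfolding g_def by (intro continuous_intros)
  have gm[measurable]: "g k \<in> borel_measurable circle" for k
    by (rule continuous_measurable_circle[OF gc])
  have Cm: "(\<lambda>z. indicator C z :: real) \<in> borel_measurable circle"
    using C by (intro borel_measurable_circle) auto
  have "(\<lambda>k. LINT z|circle. F z * of_real (g k z)) \<longlonglongrightarrow> (LINT z|circle. indicator C z *\<^sub>R F z)"
  proof (rule integral_dominated_convergence)
    show "integrable circle (\<lambda>z. norm (F z))" using FI by simp
    show "AE z in circle. norm (F z * of_real (g k z)) \<le> norm (F z)" for k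
    proof (rule AE_circleI)
      fix z :: complex assume z: "norm z = 1"
      have "\<bar>g k z\<bar> \<le> 1" by (simp add: g_def infdist_nonneg)
      then show "norm (F z * of_real (g k z)) \<le> norm (F z)"
        by (simp add: norm_mult mult_left_le)
    qed
    show "AE z in circle. (\<lambda>k. F z * of_real (g k z)) \<longlonglongrightarrow> indicator C z *\<^sub>R F z"
    proof (rule AE_circleI)
      fix z :: complex
      have "(\<lambda>k. g k z) \<longlonglongrightarrow> indicator C z"
      proof (cases "z \<in> C")
        case True then show ?thesis by (simp add: g_def)
      next
        case zC: False
        then have pos: "infdist z C > 0"
          using C False by (simp add: infdist_pos_not_in_closed)
        obtain N where N: "real N * infdist z C > 1"
          using reals_Archimedean3[OF pos] by blast
        have "g k z = 0" if "k \<ge> N" for k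
        proof -
          have "real N * infdist z C \<le> real k * infdist z C"
            using that pos by (intro mult_right_mono) auto
          then show ?thesis using N by (simp add: g_def)
        qed
        then have "eventually (\<lambda>k. g k z = 0) sequentially"
          by (auto simp: eventually_sequentially)
        then show ?thesis using zC by (simp add: tendsto_eventually)
      qed
      then have "(\<lambda>k. F z * of_real (g k z)) \<longlonglongrightarrow> F z * of_real (indicator C z)"
        by (intro tendsto_intros)
      then show "(\<lambda>k. F z * of_real (g k z)) \<longlonglongrightarrow> indicator C z *\<^sub>R F z"
        by (simp add: scaleR_conv_of_real mult.commute)
    qed
  qed (use Cm in measurable)
  then show ?thesis
    by (simp add: fourier_null_integral_continuous[OF F gc] LIMSEQ_const_iff)
qed simp

lemma sphere_Int_borel: "S \<in> sets borel \<Longrightarrow> S \<inter> sphere 0 1 \<in> sets circle"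
  unfolding sets_circle sets_restrict_space by auto

lemma sets_circleE:
  assumes "A \<in> sets circle" obtains S where "S \<in> sets borel" "A = S \<inter> sphere 0 1"
  using assms unfolding sets_circle sets_restrict_space by auto

text \<open>
  Closed sets form a \<open>\<pi>\<close>-system generating the Borel sets, so the integral over every Borel set
  vanishes, and an integrable function with this property is null.
\<close>

theorem fourier_null_imp_AE_zero:
  assumes F: "fourier_null F"
  shows "AE z in circle. F z = 0"
proof (rule circle.density_unique_banach)
  show FI: "integrable circle F" using F by (simp add: fourier_null_def)
  have SI: "set_integrable circle A F" if "A \<in> sets circle" for A
    unfolding set_integrable_def using that FI by (rule integrable_mult_indicator)
  have "S \<in> sigma_sets UNIV (Collect closed) \<Longrightarrow> (LINT z:S \<inter> sphere 0 1|circle. F z) = 0" for S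
  proof (erule sigma_sets_induct_disjoint[rotated 2])
    show "Int_stable (Collect (closed :: complex set \<Rightarrow> bool))" by (auto simp: Int_stable_def)
    fix S :: "complex set"
    have "(LINT z:S \<inter> sphere 0 1|circle. F z) = (LINT z|circle. indicator S z *\<^sub>R F z)" for S :: "complex set"
      unfolding set_lebesgue_integral_def
      by (rule Bochner_Integration.integral_cong) (auto simp: indicator_def)
    note eq = this
    show "S \<in> Collect closed \<Longrightarrow> (LINT z:S \<inter> sphere 0 1|circle. F z) = 0"
      unfolding eq using fourier_null_integral_closed[OF F] by simp
    show "(LINT z:{} \<inter> sphere 0 1|circle. F z) = 0"
      by (simp add: set_lebesgue_integral_def)
    {
      assume S: "S \<in> sigma_sets UNIV (Collect closed)" and "(LINT z:S \<inter> sphere 0 1|circle. F z) = 0"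
      then have S': "S \<in> sets borel" by (simp add: borel_eq_closed)
      have "(LINT z:UNIV \<inter> sphere 0 1|circle. F z)
          = (LINT z:(S \<inter> sphere 0 1) \<union> ((UNIV - S) \<inter> sphere 0 1)|circle. F z)"
        by (rule arg_cong[where f="\<lambda>A. set_lebesgue_integral circle A F"]) auto
      also have "\<dots> = (LINT z:S \<inter> sphere 0 1|circle. F z) + (LINT z:(UNIV - S) \<inter> sphere 0 1|circle. F z)"
        using S' by (intro set_integral_Un SI sphere_Int_borel) auto
      also have "(LINT z:UNIV \<inter> sphere 0 1|circle. F z) = 0"
        unfolding eq using fourier_null_integral_closed[OF F, of UNIV] by simp
      finally show "(LINT z:(UNIV - S) \<inter> sphere 0 1|circle. F z) = 0"
        using \<open>(LINT z:S \<inter> sphere 0 1|circle. F z) = 0\<close> by simp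
    }
    fix A :: "nat \<Rightarrow> complex set"
    assume A: "disjoint_family A" "range A \<subseteq> sigma_sets UNIV (Collect closed)"
      "\<And>i. (LINT z:A i \<inter> sphere 0 1|circle. F z) = 0"
    have Am: "A i \<in> sets borel" for i using A(2) by (auto simp: borel_eq_closed)
    have "(LINT z:(\<Union>i. A i \<inter> sphere 0 1)|circle. F z) = (\<Sum>i. (LINT z:A i \<inter> sphere 0 1|circle. F z))"
      using A(1) Am
      by (intro lebesgue_integral_countable_add SI sphere_Int_borel sets.countable_UN)
         (auto simp: disjoint_family_on_def intro: sphere_Int_borel)
    then show "(LINT z:(\<Union>i. A i) \<inter> sphere 0 1|circle. F z) = 0" using A(3) by simp
  qed auto
  then have borel: "(LINT z:S \<inter> sphere 0 1|circle. F z) = 0" if "S \<in> sets borel" for S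
    using that by (simp add: borel_eq_closed)
  show "(LINT z:A|circle. F z) = (LINT z:A|circle. 0)" if A: "A \<in> sets circle" for A
  proof -
    obtain S where "S \<in> sets borel" "A = S \<inter> sphere 0 1"
      using sets_circleE[OF A] .
    with borel[of S] show ?thesis by (simp add: set_lebesgue_integral_def)
  qed
qed simp

section \<open>The Hilbert space of square integrable functions\<close>

definition L2_sqnorm :: "(complex \<Rightarrow> complex) \<Rightarrow> real" where
  "L2_sqnorm f = (LINT z|circle. (norm (f z))\<^sup>2)"

lemma L2_measurable: "f \<in> L2_circle \<Longrightarrow> f \<in> borel_measurable circle"
  by (simp add: L2_circle_def)

lemma L2_integrable_norm2: "f \<in> L2_circle \<Longrightarrow> integrable circle (\<lambda>z. (norm (f z))\<^sup>2)"
  by (simp add: L2_circle_def)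

lemma L2_sqnorm_nonneg: "L2_sqnorm f \<ge> 0"
  by (simp add: L2_sqnorm_def)

lemma L2_mult_integrable:
  assumes f: "f \<in> L2_circle" and g: "g \<in> L2_circle"
  shows "integrable circle (\<lambda>z. f z * g z)"
proof (rule Bochner_Integration.integrable_bound)
  show "integrable circle (\<lambda>z. (norm (f z))\<^sup>2 + (norm (g z))\<^sup>2)"
    using assms by (intro Bochner_Integration.integrable_add L2_integrable_norm2)
  show "AE z in circle. norm (f z * g z) \<le> norm ((norm (f z))\<^sup>2 + (norm (g z))\<^sup>2)"
  proof (rule AE_circleI)
    fix z
    have "norm (f z) * norm (g z) \<le> (norm (f z))\<^sup>2 + (norm (g z))\<^sup>2"
      using sum_squares_bound[of "norm (f z)" "norm (g z)"]
        mult_nonneg_nonneg[OF norm_ge_zero[of "f z"] norm_ge_zero[of "g z"]] by linarith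
    then show "norm (f z * g z) \<le> norm ((norm (f z))\<^sup>2 + (norm (g z))\<^sup>2)"
      by (simp add: norm_mult)
  qed
qed (use L2_measurable[OF f] L2_measurable[OF g] in measurable)

lemma L2_bounded:
  assumes "f \<in> borel_measurable circle" "AE z in circle. norm (f z) \<le> C"
  shows "f \<in> L2_circle"
proof -
  have "integrable circle (\<lambda>z. (norm (f z))\<^sup>2)"
  proof (rule circle.integrable_const_bound)
    show "AE z in circle. norm ((norm (f z))\<^sup>2) \<le> C\<^sup>2"
      using assms(2) by eventually_elim (simp add: power_mono)
  qed (use assms(1) in measurable)
  then show ?thesis using assms(1) by (simp add: L2_circle_def)
qed

lemma Linf_subset_L2: "f \<in> Linf_circle \<Longrightarrow> f \<in> L2_circle"
  by (auto simp: Linf_circle_def intro: L2_bounded)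

lemma L2_const: "(\<lambda>z. c) \<in> L2_circle"
  by (rule L2_bounded[where C="norm c"]) auto

lemma L2_powi: "(\<lambda>z. z powi n) \<in> L2_circle"
  by (rule L2_bounded[where C=1]) (auto intro!: AE_circleI simp: norm_power_int)

lemma L2_integrable: "f \<in> L2_circle \<Longrightarrow> integrable circle f"
  using L2_mult_integrable[OF _ L2_const[of 1]] by simp

lemma L2_add:
  assumes f: "f \<in> L2_circle" and g: "g \<in> L2_circle"
  shows "(\<lambda>z. f z + g z) \<in> L2_circle"
proof -
  have "integrable circle (\<lambda>z. (norm (f z + g z))\<^sup>2)"
  proof (rule Bochner_Integration.integrable_bound)
    show "integrable circle (\<lambda>z. 2 * ((norm (f z))\<^sup>2 + (norm (g z))\<^sup>2))"
      using assms by (intro integrable_mult_right Bochner_Integration.integrable_add L2_integrable_norm2)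
    show "AE z in circle. norm ((norm (f z + g z))\<^sup>2) \<le> norm (2 * ((norm (f z))\<^sup>2 + (norm (g z))\<^sup>2))"
    proof (rule AE_circleI)
      fix z
      have "(norm (f z + g z))\<^sup>2 \<le> (norm (f z) + norm (g z))\<^sup>2"
        by (simp add: power_mono norm_triangle_ineq)
      also have "\<dots> \<le> 2 * ((norm (f z))\<^sup>2 + (norm (g z))\<^sup>2)"
        using sum_squares_bound[of "norm (f z)" "norm (g z)"] by (simp add: power2_sum)
      finally show "norm ((norm (f z + g z))\<^sup>2) \<le> norm (2 * ((norm (f z))\<^sup>2 + (norm (g z))\<^sup>2))"
        by simp
    qed
  qed (use L2_measurable[OF f] L2_measurable[OF g] in measurable)
  then show ?thesis
    using L2_measurable[OF f] L2_measurable[OF g] by (simp add: L2_circle_def)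
qed

lemma L2_mult_bounded:
  assumes f: "f \<in> L2_circle" and g: "g \<in> Linf_circle"
  shows "(\<lambda>z. g z * f z) \<in> L2_circle"
proof -
  obtain C where gm: "g \<in> borel_measurable circle" and C: "AE z in circle. norm (g z) \<le> C"
    using g by (auto simp: Linf_circle_def)
  have "integrable circle (\<lambda>z. (norm (g z * f z))\<^sup>2)"
  proof (rule Bochner_Integration.integrable_bound)
    show "integrable circle (\<lambda>z. C\<^sup>2 * (norm (f z))\<^sup>2)"
      using f by (intro integrable_mult_right L2_integrable_norm2)
    show "AE z in circle. norm ((norm (g z * f z))\<^sup>2) \<le> norm (C\<^sup>2 * (norm (f z))\<^sup>2)"
      using C by eventually_elim (simp add: norm_mult power_mult_distrib mult_right_mono power_mono)
  qed (use L2_measurable[OF f] gm in measurable)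
  then show ?thesis
    using L2_measurable[OF f] gm by (simp add: L2_circle_def)
qed

lemma Linf_powi: "(\<lambda>z. z powi n) \<in> Linf_circle"
  by (auto simp: Linf_circle_def norm_power_int intro!: exI[of _ 1] AE_circleI)

lemma Linf_const: "(\<lambda>z. c) \<in> Linf_circle"
  by (auto simp: Linf_circle_def)

lemma L2_cmult: "f \<in> L2_circle \<Longrightarrow> (\<lambda>z. c * f z) \<in> L2_circle"
  by (rule L2_mult_bounded[OF _ Linf_const])

lemma L2_diff: "f \<in> L2_circle \<Longrightarrow> g \<in> L2_circle \<Longrightarrow> (\<lambda>z. f z - g z) \<in> L2_circle"
  using L2_add[of f "\<lambda>z. (-1) * g z"] L2_cmult[of g "-1"] by simp

lemma L2_cnj: "f \<in> L2_circle \<Longrightarrow> (\<lambda>z. cnj (f z)) \<in> L2_circle"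
  by (auto simp: L2_circle_def intro: measurable_compose[OF _ borel_measurable_continuous_onI[OF continuous_on_cnj[OF continuous_on_id]]])

lemma L2_sum: "(\<And>n. n \<in> A \<Longrightarrow> f n \<in> L2_circle) \<Longrightarrow> (\<lambda>z. \<Sum>n\<in>A. f n z) \<in> L2_circle"
  by (induction A rule: infinite_finite_induct) (auto intro: L2_const L2_add)

lemma L2_flip: "f \<in> L2_circle \<Longrightarrow> J_flip f \<in> L2_circle"
  using integrable_cnj_flip[of "\<lambda>z. (norm (f z))\<^sup>2"] measurable_compose[OF cnj_measurable_circle, of f borel]
  by (simp add: L2_circle_def J_flip_def)

lemma L2_inner_integrable:
  "f \<in> L2_circle \<Longrightarrow> g \<in> L2_circle \<Longrightarrow> integrable circle (\<lambda>z. f z * cnj (g z))"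
  by (intro L2_mult_integrable L2_cnj)

lemma L2_inner_add_left:
  "f \<in> L2_circle \<Longrightarrow> g \<in> L2_circle \<Longrightarrow> h \<in> L2_circle \<Longrightarrow>
    L2_inner (\<lambda>z. f z + g z) h = L2_inner f h + L2_inner g h"
  by (simp add: L2_inner_def ring_distribs L2_inner_integrable)

lemma L2_inner_diff_left:
  "f \<in> L2_circle \<Longrightarrow> g \<in> L2_circle \<Longrightarrow> h \<in> L2_circle \<Longrightarrow>
    L2_inner (\<lambda>z. f z - g z) h = L2_inner f h - L2_inner g h"
  by (simp add: L2_inner_def ring_distribs L2_inner_integrable)

lemma L2_inner_commute: "L2_inner g f = cnj (L2_inner f g)"
  unfolding L2_inner_def by (subst Bochner_Integration.integral_cnj[symmetric]) (simp add: mult.commute)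

lemma L2_inner_self: "L2_inner f f = of_real (L2_sqnorm f)"
  unfolding L2_inner_def L2_sqnorm_def complex_norm_square[symmetric]
  by (rule integral_complex_of_real)

lemma L2_inner_powi: "L2_inner f (\<lambda>z. z powi n) = fourier_coeff f n"
  by (simp add: L2_inner_def fourier_coeff_def)

lemma L2_inner_trig_sum:
  assumes "finite A" "f \<in> L2_circle"
  shows "L2_inner f (\<lambda>z. \<Sum>n\<in>A. a n * z powi n) = (\<Sum>n\<in>A. cnj (a n) * fourier_coeff f n)"
  using assms(1)
proof induction
  case (insert n A)
  have T: "(\<lambda>z. \<Sum>n\<in>A. a n * z powi n) \<in> L2_circle"
    by (intro L2_sum L2_cmult L2_powi)
  have "L2_inner f (\<lambda>z. \<Sum>n\<in>insert n A. a n * z powi n)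
      = cnj (L2_inner (\<lambda>z. a n * z powi n + (\<Sum>n\<in>A. a n * z powi n)) f)"
    using insert.hyps by (subst L2_inner_commute) simp
  also have "\<dots> = cnj (L2_inner (\<lambda>z. a n * z powi n) f) + L2_inner f (\<lambda>z. \<Sum>n\<in>A. a n * z powi n)"
    by (subst L2_inner_add_left) (auto intro: L2_cmult L2_powi T assms simp flip: L2_inner_commute)
  also have "cnj (L2_inner (\<lambda>z. a n * z powi n) f) = cnj (a n) * fourier_coeff f n"
  proof -
    have "L2_inner (\<lambda>z. a n * z powi n) f = a n * L2_inner (\<lambda>z. z powi n) f"
      by (simp add: L2_inner_def mult.assoc)
    also have "cnj \<dots> = cnj (a n) * L2_inner f (\<lambda>z. z powi n)"
      by (subst (2) L2_inner_commute) simp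
    finally show ?thesis by (simp add: L2_inner_powi)
  qed
  finally show ?case using insert by simp
qed (simp add: L2_inner_def)

lemma fourier_coeff_sum:
  assumes "finite A" "\<And>k. k \<in> A \<Longrightarrow> integrable circle (f k)"
  shows "fourier_coeff (\<lambda>z. \<Sum>k\<in>A. f k z) n = (\<Sum>k\<in>A. fourier_coeff (f k) n)"
  using assms
proof (induction A rule: finite_induct)
  case empty
  then show ?case by (simp add: fourier_coeff_eq)
next
  case (insert a A)
  then show ?case by (simp add: fourier_coeff_add)
qed

lemma fourier_coeff_trig_sum:
  assumes "finite A"
  shows "fourier_coeff (\<lambda>z. \<Sum>k\<in>A. a k * z powi k) n = (if n \<in> A then a n else 0)"
proof -
  have "fourier_coeff (\<lambda>z. \<Sum>k\<in>A. a k * z powi k) n = (\<Sum>k\<in>A. a k * (if n = k then 1 else 0))"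
    using assms by (subst fourier_coeff_sum)
      (auto intro!: L2_integrable[OF L2_cmult[OF L2_powi]] simp: fourier_coeff_cmult fourier_coeff_powi)
  also have "\<dots> = (\<Sum>k\<in>A. if n = k then a k else 0)"
    by (rule sum.cong) auto
  finally show ?thesis using assms by (simp add: sum.delta)
qed

lemma L2_sqnorm_trig_sum:
  assumes "finite A"
  shows "L2_sqnorm (\<lambda>z. \<Sum>k\<in>A. a k * z powi k) = (\<Sum>k\<in>A. (norm (a k))\<^sup>2)"
proof -
  have "(of_real (L2_sqnorm (\<lambda>z. \<Sum>k\<in>A. a k * z powi k)) :: complex)
      = (\<Sum>k\<in>A. cnj (a k) * (if k \<in> A then a k else 0))"
    unfolding L2_inner_self[symmetric] using assms
    by (subst L2_inner_trig_sum) (auto intro!: L2_sum L2_cmult[OF L2_powi] simp: fourier_coeff_trig_sum)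
  also have "\<dots> = of_real (\<Sum>k\<in>A. (norm (a k))\<^sup>2)"
    by (simp add: complex_norm_square mult.commute del: of_real_power)
  finally show ?thesis by (simp only: of_real_eq_iff)
qed

text \<open>
  With \<open>T\<close> the partial sum over \<open>A\<close>, the difference of the two sides is the squared norm of \<open>f - T\<close>.
\<close>

lemma Bessel_inequality:
  assumes A: "finite A" and f: "f \<in> L2_circle"
  shows "(\<Sum>n\<in>A. (norm (fourier_coeff f n))\<^sup>2) \<le> L2_sqnorm f"
proof -
  define a where "a = fourier_coeff f"
  define T where "T = (\<lambda>z. \<Sum>n\<in>A. a n * z powi n)"
  have T: "T \<in> L2_circle" unfolding T_def by (intro L2_sum L2_cmult L2_powi)
  have fT: "L2_inner f T = of_real (\<Sum>n\<in>A. (norm (a n))\<^sup>2)"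
    unfolding T_def L2_inner_trig_sum[OF A f] by (simp add: complex_norm_square a_def mult.commute del: of_real_power)
  have TT: "L2_inner T T = of_real (\<Sum>n\<in>A. (norm (a n))\<^sup>2)"
    unfolding L2_inner_self unfolding T_def L2_sqnorm_trig_sum[OF A] ..
  have fmT: "(\<lambda>z. f z - T z) \<in> L2_circle" using f T by (rule L2_diff)
  have inner_fmT: "L2_inner (\<lambda>z. f z - T z) g = L2_inner f g - L2_inner T g" if "g \<in> L2_circle" for g
    using f T that by (rule L2_inner_diff_left)
  have "of_real (L2_sqnorm (\<lambda>z. f z - T z)) = L2_inner f (\<lambda>z. f z - T z) - L2_inner T (\<lambda>z. f z - T z)"
    unfolding L2_inner_self[symmetric] by (rule inner_fmT[OF fmT])
  also have "\<dots> = cnj (L2_inner f f - L2_inner T f) - cnj (L2_inner f T - L2_inner T T)"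
    unfolding inner_fmT[OF f, symmetric] inner_fmT[OF T, symmetric] by (simp flip: L2_inner_commute)
  also have "\<dots> = of_real (L2_sqnorm f - (\<Sum>n\<in>A. (norm (a n))\<^sup>2))"
    using L2_inner_commute[of T f] by (simp add: fT TT L2_inner_self[of f])
  finally have "L2_sqnorm (\<lambda>z. f z - T z) = L2_sqnorm f - (\<Sum>n\<in>A. (norm (a n))\<^sup>2)"
    by (simp only: of_real_eq_iff)
  then show ?thesis using L2_sqnorm_nonneg[of "\<lambda>z. f z - T z"] by (simp add: a_def)
qed

lemma L2_Cauchy_Schwarz:
  assumes f: "f \<in> L2_circle" and g: "g \<in> L2_circle"
  shows "(norm (L2_inner f g))\<^sup>2 \<le> L2_sqnorm f * L2_sqnorm g"
proof -
  note [measurable] = L2_measurable[OF f] L2_measurable[OF g]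
  have FG: "integrable circle (\<lambda>z. norm (f z) * norm (g z))"
    using integrable_norm[OF L2_mult_integrable[OF f g]] by (simp add: norm_mult)
  have "norm (L2_inner f g) \<le> (LINT z|circle. norm (f z) * norm (g z))"
    unfolding L2_inner_def by (rule order_trans[OF integral_norm_bound]) (simp add: norm_mult)
  then have "(norm (L2_inner f g))\<^sup>2 \<le> (LINT z|circle. norm (f z) * norm (g z))\<^sup>2"
    by (rule power_mono) simp
  moreover have "(LINT z|circle. norm (f z) * norm (g z))\<^sup>2 \<le> L2_sqnorm f * L2_sqnorm g"
  proof -
    have "ennreal ((LINT z|circle. norm (f z) * norm (g z))\<^sup>2)
        = (\<integral>\<^sup>+z. ennreal (norm (f z)) * ennreal (norm (g z)) \<partial>circle)\<^sup>2"
      using nn_integral_eq_integral[OF FG] by (simp add: ennreal_mult ennreal_power)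
    also have "\<dots> \<le> (\<integral>\<^sup>+z. (ennreal (norm (f z)))\<^sup>2 \<partial>circle) * (\<integral>\<^sup>+z. (ennreal (norm (g z)))\<^sup>2 \<partial>circle)"
      by (rule Cauchy_Schwarz_nn_integral) measurable
    also have "\<dots> = ennreal (L2_sqnorm f * L2_sqnorm g)"
      using nn_integral_eq_integral[OF L2_integrable_norm2[OF f]]
        nn_integral_eq_integral[OF L2_integrable_norm2[OF g]]
      by (simp add: L2_sqnorm_def ennreal_mult ennreal_power)
    finally show ?thesis
      by (simp add: L2_sqnorm_nonneg)
  qed
  ultimately show ?thesis by linarith
qed

lemma L2_inner_tendsto:
  assumes lim: "(\<lambda>k. L2_sqnorm (\<lambda>z. f k z - F z)) \<longlonglongrightarrow> 0"
    and L2: "\<And>k. f k \<in> L2_circle" "F \<in> L2_circle" "g \<in> L2_circle"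
  shows "(\<lambda>k. L2_inner (f k) g) \<longlonglongrightarrow> L2_inner F g"
proof -
  have "(\<lambda>k. (norm (L2_inner (f k) g - L2_inner F g))\<^sup>2) \<longlonglongrightarrow> 0"
  proof (rule tendsto_sandwich[OF _ _ tendsto_const])
    show "(\<lambda>k. L2_sqnorm (\<lambda>z. f k z - F z) * L2_sqnorm g) \<longlonglongrightarrow> 0"
      using tendsto_mult_right[OF lim, of "L2_sqnorm g"] by (simp add: mult.commute)
    show "\<forall>\<^sub>F k in sequentially. (norm (L2_inner (f k) g - L2_inner F g))\<^sup>2
        \<le> L2_sqnorm (\<lambda>z. f k z - F z) * L2_sqnorm g"
      using L2_Cauchy_Schwarz[OF L2_diff[OF L2(1) L2(2)] L2(3)]
      by (intro always_eventually allI) (simp add: L2_inner_diff_left L2)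
  qed simp
  then have "(\<lambda>k. sqrt ((norm (L2_inner (f k) g - L2_inner F g))\<^sup>2)) \<longlonglongrightarrow> sqrt 0"
    by (rule tendsto_real_sqrt)
  then show ?thesis by (simp add: tendsto_norm_zero_iff LIM_zero_iff)
qed

section \<open>Completeness\<close>

lemma L2_sqnorm_diff_commute: "L2_sqnorm (\<lambda>z. f z - g z) = L2_sqnorm (\<lambda>z. g z - f z)"
  by (simp add: L2_sqnorm_def norm_minus_commute)

lemma nn_integral_L2_sqnorm:
  "f \<in> L2_circle \<Longrightarrow> (\<integral>\<^sup>+z. ennreal ((norm (f z))\<^sup>2) \<partial>circle) = ennreal (L2_sqnorm f)"
  unfolding L2_sqnorm_def by (rule nn_integral_eq_integral[OF L2_integrable_norm2]) auto

text \<open>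
  The weighted inequality \<open>2 * a \<le> 2 ^ k * a\<^sup>2 + (1/2) ^ k\<close> turns a squared \<open>L\<^sup>2\<close> norm of size
  \<open>(1/4) ^ k\<close> into an \<open>L\<^sup>1\<close> norm of size \<open>(1/2) ^ k\<close>. The increments are therefore absolutely summable
  almost everywhere.
\<close>

lemma L2_fast_Cauchy_converges_AE:
  assumes L2: "\<And>k. f k \<in> L2_circle"
    and fast: "\<And>k. L2_sqnorm (\<lambda>z. f (Suc k) z - f k z) \<le> (1/4)^k"
  shows "AE z in circle. convergent (\<lambda>k. f k z)"
proof -
  define d where "d k z = f (Suc k) z - f k z" for k z
  have dL2: "d k \<in> L2_circle" for k unfolding d_def by (intro L2_diff L2)
  note [measurable] = L2_measurable[OF dL2]
  have dint: "(\<integral>\<^sup>+z. ennreal (norm (d k z)) \<partial>circle) \<le> ennreal ((1/2)^k)" for k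
  proof -
    have I: "integrable circle (\<lambda>z. norm (d k z))" using L2_integrable[OF dL2] by simp
    have "(LINT z|circle. norm (d k z)) \<le> (LINT z|circle. (2^k * (norm (d k z))\<^sup>2 + (1/2)^k) / 2)"
    proof (rule integral_mono[OF I])
      show "integrable circle (\<lambda>z. (2^k * (norm (d k z))\<^sup>2 + (1/2)^k) / 2)"
        using L2_integrable_norm2[OF dL2] by simp
      fix z
      have "0 \<le> 2^k * (norm (d k z) - (1/2)^k)\<^sup>2" by simp
      also have "\<dots> = 2^k * (norm (d k z))\<^sup>2 - 2 * norm (d k z) * (2^k * (1/2)^k) + (2^k * (1/2)^k) * (1/2)^k"
        by (simp add: power2_eq_square algebra_simps)
      also have "(2::real)^k * (1/2)^k = 1" by (simp flip: power_mult_distrib)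
      finally show "norm (d k z) \<le> (2^k * (norm (d k z))\<^sup>2 + (1/2)^k) / 2" by simp
    qed
    also have "\<dots> = (2^k * L2_sqnorm (d k) + (1/2)^k) / 2"
      using L2_integrable_norm2[OF dL2] circle.prob_space by (simp add: L2_sqnorm_def)
    also have "\<dots> \<le> (2^k * (1/4)^k + (1/2)^k) / 2"
      using fast[of k] by (simp add: d_def[abs_def])
    also have "(2::real)^k * (1/4)^k = (1/2)^k" by (simp flip: power_mult_distrib)
    finally show ?thesis
      by (subst nn_integral_eq_integral[OF I]) (auto intro: ennreal_leI)
  qed
  have "(\<integral>\<^sup>+z. (\<Sum>k. ennreal (norm (d k z))) \<partial>circle) = (\<Sum>k. \<integral>\<^sup>+z. ennreal (norm (d k z)) \<partial>circle)"
    by (rule nn_integral_suminf) measurable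
  also have "\<dots> \<le> (\<Sum>k. ennreal ((1/2)^k))"
    by (intro suminf_le dint summableI)
  also have "\<dots> < \<infinity>"
    unfolding infinity_ennreal_def less_top[symmetric]
    by (intro ennreal_suminf_neq_top summable_geometric) auto
  finally have "AE z in circle. (\<Sum>k. ennreal (norm (d k z))) \<noteq> \<infinity>"
    by (intro nn_integral_PInf_AE) auto
  then show ?thesis
  proof eventually_elim
    case (elim z)
    then have "summable (\<lambda>k. norm (d k z))" by (intro summable_suminf_not_top) auto
    then have "summable (\<lambda>k. d k z)" by (rule summable_norm_cancel)
    then have "convergent (\<lambda>n. \<Sum>k<n. d k z)" by (simp add: summable_iff_convergent)
    moreover have "(\<Sum>k<n. d k z) = f n z - f 0 z" for n
      unfolding d_def by (rule sum_lessThan_telescope)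
    ultimately show "convergent (\<lambda>n. f n z)"
      by (simp add: convergent_diff_const_right_iff)
  qed
qed

text \<open>
  A sufficiently sparse subsequence converges almost everywhere, and Fatou's lemma along it bounds
  the \<open>L\<^sup>2\<close> distance from \<open>f n\<close> to the pointwise limit.
\<close>

theorem L2_circle_complete:
  assumes L2: "\<And>k. f k \<in> L2_circle"
    and Cauchy: "\<And>e. e > 0 \<Longrightarrow> \<exists>N. \<forall>m\<ge>N. \<forall>n\<ge>N. L2_sqnorm (\<lambda>z. f m z - f n z) \<le> e"
  obtains g where "g \<in> L2_circle" "(\<lambda>k. L2_sqnorm (\<lambda>z. f k z - g z)) \<longlonglongrightarrow> 0"
proof -
  have "\<exists>N. \<forall>m\<ge>N. \<forall>n\<ge>N. L2_sqnorm (\<lambda>z. f m z - f n z) \<le> (1/4)^k" for k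
    by (rule Cauchy) simp
  then obtain N where N: "\<And>k m n. m \<ge> N k \<Longrightarrow> n \<ge> N k \<Longrightarrow> L2_sqnorm (\<lambda>z. f m z - f n z) \<le> (1/4)^k"
    by metis
  \<comment> \<open>Both \<open>r k\<close> and \<open>r (Suc k)\<close> lie beyond \<open>N k\<close>, and the summand \<open>k\<close> makes \<open>r\<close> unbounded.\<close>
  define r where "r k = k + (\<Sum>j\<le>k. N j)" for k
  have r: "r k \<ge> N k" "r (Suc k) \<ge> N k" "r k \<ge> k" for k
  proof -
    have "N k \<le> (\<Sum>j\<le>k. N j)" by (rule member_le_sum) auto
    then show "r k \<ge> N k" "r (Suc k) \<ge> N k" "r k \<ge> k" by (simp_all add: r_def)
  qed
  define g where "g z = lim (\<lambda>k. f (r k) z)" for z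
  note [measurable] = L2_measurable[OF L2]
  have gm[measurable]: "g \<in> borel_measurable circle" unfolding g_def by measurable
  have conv: "AE z in circle. (\<lambda>k. f (r k) z) \<longlonglongrightarrow> g z"
    using L2_fast_Cauchy_converges_AE[of "\<lambda>k. f (r k)", OF L2 N[OF r(2) r(1)]]
    by eventually_elim (simp add: g_def convergent_LIMSEQ_iff)
  have bound: "(\<integral>\<^sup>+z. ennreal ((norm (f n z - g z))\<^sup>2) \<partial>circle) \<le> ennreal e"
    if M: "\<And>m. m \<ge> M \<Longrightarrow> L2_sqnorm (\<lambda>z. f n z - f m z) \<le> e" for n M e
  proof -
    have "(\<integral>\<^sup>+z. ennreal ((norm (f n z - g z))\<^sup>2) \<partial>circle)
        = (\<integral>\<^sup>+z. liminf (\<lambda>k. ennreal ((norm (f n z - f (r k) z))\<^sup>2)) \<partial>circle)"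
    proof (rule nn_integral_cong_AE)
      show "AE z in circle. ennreal ((norm (f n z - g z))\<^sup>2)
          = liminf (\<lambda>k. ennreal ((norm (f n z - f (r k) z))\<^sup>2))"
        using conv
      proof eventually_elim
        case (elim z)
        then have "(\<lambda>k. ennreal ((norm (f n z - f (r k) z))\<^sup>2)) \<longlonglongrightarrow> ennreal ((norm (f n z - g z))\<^sup>2)"
          by (intro tendsto_intros)
        then show ?case by (intro lim_imp_Liminf[symmetric]) auto
      qed
    qed
    also have "\<dots> \<le> liminf (\<lambda>k. \<integral>\<^sup>+z. ennreal ((norm (f n z - f (r k) z))\<^sup>2) \<partial>circle)"
      by (rule nn_integral_liminf) measurable
    also have "\<dots> = liminf (\<lambda>k. ennreal (L2_sqnorm (\<lambda>z. f n z - f (r k) z)))"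
      by (simp add: nn_integral_L2_sqnorm L2_diff L2)
    also have "\<dots> \<le> ennreal e"
    proof (rule Liminf_le)
      show "\<forall>\<^sub>F k in sequentially. ennreal (L2_sqnorm (\<lambda>z. f n z - f (r k) z)) \<le> ennreal e"
        using eventually_ge_at_top[of M]
      proof eventually_elim
        case (elim k)
        then show ?case using M[of "r k"] r(3)[of k] by (intro ennreal_leI) auto
      qed
    qed simp
    finally show ?thesis .
  qed
  have diffL2: "(\<lambda>z. f n z - g z) \<in> L2_circle" if "n \<ge> N 0" for n
  proof -
    have "(\<integral>\<^sup>+z. ennreal ((norm (f n z - g z))\<^sup>2) \<partial>circle) \<le> ennreal 1"
      using N[of 0 n] that by (intro bound[of "N 0"]) auto
    then have "integrable circle (\<lambda>z. (norm (f n z - g z))\<^sup>2)"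
      by (intro integrableI_bounded) (auto simp: less_top[symmetric] top_unique)
    then show ?thesis by (simp add: L2_circle_def)
  qed
  have "g \<in> L2_circle"
    using L2_diff[OF L2[of "N 0"] diffL2[of "N 0"]] by simp
  moreover have "(\<lambda>n. L2_sqnorm (\<lambda>z. f n z - g z)) \<longlonglongrightarrow> 0"
  proof (rule LIMSEQ_I)
    fix e :: real assume e: "e > 0"
    obtain M where M: "\<And>m n. m \<ge> M \<Longrightarrow> n \<ge> M \<Longrightarrow> L2_sqnorm (\<lambda>z. f m z - f n z) \<le> e / 2"
      using Cauchy[of "e / 2"] e by auto
    have "norm (L2_sqnorm (\<lambda>z. f n z - g z) - 0) < e" if n: "n \<ge> max M (N 0)" for n
    proof -
      have "ennreal (L2_sqnorm (\<lambda>z. f n z - g z)) \<le> ennreal (e / 2)"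
        using bound[of M n "e / 2"] M n by (simp add: nn_integral_L2_sqnorm[OF diffL2])
      then have "L2_sqnorm (\<lambda>z. f n z - g z) \<le> e / 2" using e by (simp add: ennreal_le_iff)
      then show ?thesis using e L2_sqnorm_nonneg[of "\<lambda>z. f n z - g z"] by simp
    qed
    then show "\<exists>no. \<forall>n\<ge>no. norm (L2_sqnorm (\<lambda>z. f n z - g z) - 0) < e" by blast
  qed
  ultimately show ?thesis by (rule that)
qed

section \<open>The Riesz projection\<close>

text \<open>
  These are the partial sums of the projection of \<open>f\<close> onto \<open>H\<^sup>2\<close>. The index set consists of integers
  so that the results on trigonometric sums apply.
\<close>

definition hardy_sum :: "(complex \<Rightarrow> complex) \<Rightarrow> nat \<Rightarrow> complex \<Rightarrow> complex" where
  "hardy_sum f N = (\<lambda>z. \<Sum>n\<in>int ` {..<N}. fourier_coeff f n * z powi n)"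

lemma L2_hardy_sum: "hardy_sum f N \<in> L2_circle"
  unfolding hardy_sum_def by (intro L2_sum L2_cmult L2_powi)

lemma fourier_coeff_hardy_sum:
  "fourier_coeff (hardy_sum f N) n = (if n \<in> int ` {..<N} then fourier_coeff f n else 0)"
  unfolding hardy_sum_def by (rule fourier_coeff_trig_sum) simp

lemma fourier_coeff_tendsto:
  assumes "(\<lambda>k. L2_sqnorm (\<lambda>z. f k z - F z)) \<longlonglongrightarrow> 0" "\<And>k. f k \<in> L2_circle" "F \<in> L2_circle"
  shows "(\<lambda>k. fourier_coeff (f k) n) \<longlonglongrightarrow> fourier_coeff F n"
  using L2_inner_tendsto[OF assms L2_powi[of n]] by (simp add: L2_inner_powi)

text \<open>
  This constructs the orthogonal projection onto \<open>H\<^sup>2\<close>: the nonnegative Fourier coefficients are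
  square summable by Bessel's inequality, so completeness provides a limit.
\<close>

theorem hardy_sum_converges:
  assumes f: "f \<in> L2_circle"
  obtains g where "g \<in> Hardy2" "\<And>n. n \<ge> 0 \<Longrightarrow> fourier_coeff g n = fourier_coeff f n"
    "(\<lambda>N. L2_sqnorm (\<lambda>z. hardy_sum f N z - g z)) \<longlonglongrightarrow> 0"
proof -
  define c where "c n = (norm (fourier_coeff f (int n)))\<^sup>2" for n
  have "summable c"
  proof (rule summableI_nonneg_bounded)
    show "sum c {..<n} \<le> L2_sqnorm f" for n
      using Bessel_inequality[OF _ f, of "int ` {..<n}"] by (simp add: c_def sum.reindex)
  qed (simp add: c_def)
  have le: "L2_sqnorm (\<lambda>z. hardy_sum f m z - hardy_sum f n z) = sum c {n..<m}" if "n \<le> m" for m n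
  proof -
    have "int ` {..<m} - int ` {..<n} = int ` {n..<m}"
      by (subst image_set_diff[symmetric]) (auto intro!: arg_cong[of _ _ "image int"])
    then have "hardy_sum f m z - hardy_sum f n z = (\<Sum>k\<in>int ` {n..<m}. fourier_coeff f k * z powi k)" for z
      unfolding hardy_sum_def using that
      by (subst sum_diff[symmetric]) auto
    then have "L2_sqnorm (\<lambda>z. hardy_sum f m z - hardy_sum f n z) = (\<Sum>k\<in>int ` {n..<m}. (norm (fourier_coeff f k))\<^sup>2)"
      by (simp add: L2_sqnorm_trig_sum)
    then show ?thesis by (simp add: sum.reindex c_def)
  qed
  have "\<exists>N. \<forall>m\<ge>N. \<forall>n\<ge>N. L2_sqnorm (\<lambda>z. hardy_sum f m z - hardy_sum f n z) \<le> e" if e: "e > 0" for e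
  proof -
    obtain N where N: "\<And>m n. m \<ge> N \<Longrightarrow> norm (sum c {m..<n}) < e"
      using \<open>summable c\<close> e unfolding summable_Cauchy by blast
    have "L2_sqnorm (\<lambda>z. hardy_sum f m z - hardy_sum f n z) \<le> e" if "m \<ge> N" "n \<ge> N" for m n
    proof (cases "n \<le> m")
      case True
      then show ?thesis using le[OF True] N[OF \<open>n \<ge> N\<close>, of m] by auto
    next
      case False
      then show ?thesis using le[of m n] N[OF \<open>m \<ge> N\<close>, of n]
        by (subst L2_sqnorm_diff_commute) auto
    qed
    then show ?thesis by blast
  qed
  then obtain g where g: "g \<in> L2_circle" "(\<lambda>N. L2_sqnorm (\<lambda>z. hardy_sum f N z - g z)) \<longlonglongrightarrow> 0"
    using L2_circle_complete[of "hardy_sum f"] L2_hardy_sum by blast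
  have lim: "(\<lambda>N. fourier_coeff (hardy_sum f N) n) \<longlonglongrightarrow> fourier_coeff g n" for n
    by (rule fourier_coeff_tendsto[OF g(2) L2_hardy_sum g(1)])
  have neg: "fourier_coeff g n = 0" if "n < 0" for n
  proof -
    have "n \<notin> int ` {..<N}" for N using that by auto
    then show ?thesis using lim[of n] by (simp add: fourier_coeff_hardy_sum LIMSEQ_const_iff)
  qed
  have nonneg: "fourier_coeff g n = fourier_coeff f n" if "n \<ge> 0" for n
  proof -
    have "\<forall>\<^sub>F N in sequentially. fourier_coeff (hardy_sum f N) n = fourier_coeff f n"
      using eventually_gt_at_top[of "nat n"]
    proof eventually_elim
      case (elim N)
      then have "n \<in> int ` {..<N}" using that by (intro image_eqI[of _ _ "nat n"]) auto
      then show ?case by (simp add: fourier_coeff_hardy_sum)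
    qed
    from LIMSEQ_unique[OF lim tendsto_eventually[OF this]] show ?thesis .
  qed
  show ?thesis by (rule that[of g]) (use g neg nonneg in \<open>auto simp: Hardy2_def\<close>)
qed

lemma Hardy2_L2: "h \<in> Hardy2 \<Longrightarrow> h \<in> L2_circle"
  by (simp add: Hardy2_def)

lemma Hardy2_fourier_coeff_neg: "h \<in> Hardy2 \<Longrightarrow> n < 0 \<Longrightarrow> fourier_coeff h n = 0"
  by (simp add: Hardy2_def)

lemma L2_eq_AE_iff_fourier_coeff:
  assumes "f \<in> L2_circle" "g \<in> L2_circle"
  shows "(AE z in circle. f z = g z) \<longleftrightarrow> (\<forall>n. fourier_coeff f n = fourier_coeff g n)"
proof
  assume "\<forall>n. fourier_coeff f n = fourier_coeff g n"
  then have "fourier_null (\<lambda>z. f z - g z)"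
    using assms by (simp add: fourier_null_def fourier_coeff_diff L2_integrable)
  from fourier_null_imp_AE_zero[OF this] show "AE z in circle. f z = g z" by simp
qed (use assms fourier_coeff_cong_AE L2_measurable in blast)

lemma Hardy2_eq_AE:
  assumes "f \<in> Hardy2" "g \<in> Hardy2" "\<And>n. n \<ge> 0 \<Longrightarrow> fourier_coeff f n = fourier_coeff g n"
  shows "AE z in circle. f z = g z"
  using assms Hardy2_fourier_coeff_neg
  by (subst L2_eq_AE_iff_fourier_coeff) (auto simp: Hardy2_L2, metis linorder_not_le)

lemma L2_inner_cong_AE:
  assumes "f \<in> L2_circle" "f' \<in> L2_circle" "g \<in> L2_circle" "g' \<in> L2_circle"
    and "AE z in circle. f z = f' z" "AE z in circle. g z = g' z"
  shows "L2_inner f g = L2_inner f' g'"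
  unfolding L2_inner_def
proof (rule integral_cong_AE)
  show "AE z in circle. f z * cnj (g z) = f' z * cnj (g' z)"
    using assms(5,6) by eventually_elim simp
qed (rule borel_measurable_integrable[OF L2_inner_integrable[OF assms(1,3)]]
      borel_measurable_integrable[OF L2_inner_integrable[OF assms(2,4)]])+

text \<open>
  For the partial sums of \<open>h\<close> the inner product is a finite sum of zeros. They converge to \<open>h\<close> in
  \<open>L\<^sup>2\<close>, because their limit has the Fourier coefficients of \<open>h\<close>.
\<close>

theorem L2_inner_Hardy2_eq_0:
  assumes f: "f \<in> L2_circle" "\<And>n. n \<ge> 0 \<Longrightarrow> fourier_coeff f n = 0" and h: "h \<in> Hardy2"
  shows "L2_inner f h = 0"
proof -
  obtain g where g: "g \<in> Hardy2" "\<And>n. n \<ge> 0 \<Longrightarrow> fourier_coeff g n = fourier_coeff h n"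
    "(\<lambda>N. L2_sqnorm (\<lambda>z. hardy_sum h N z - g z)) \<longlonglongrightarrow> 0"
    using hardy_sum_converges[OF Hardy2_L2[OF h]] by blast
  have "L2_inner f (hardy_sum h N) = 0" for N
    unfolding hardy_sum_def using f by (subst L2_inner_trig_sum) (auto intro!: sum.neutral)
  then have "L2_inner (hardy_sum h N) f = 0" for N
    by (subst L2_inner_commute) simp
  then have "L2_inner g f = 0"
    using L2_inner_tendsto[OF g(3) L2_hardy_sum Hardy2_L2[OF g(1)] f(1)]
    by (simp add: LIMSEQ_const_iff)
  then have "L2_inner f g = 0" by (subst L2_inner_commute) simp
  moreover have "L2_inner f h = L2_inner f g"
    by (rule L2_inner_cong_AE[OF f(1) f(1) Hardy2_L2[OF h] Hardy2_L2[OF g(1)] _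
          Hardy2_eq_AE[OF h g(1) g(2)[symmetric]]]) auto
  ultimately show ?thesis by simp
qed

lemma Hardy2_powi: "n \<ge> 0 \<Longrightarrow> (\<lambda>z. z powi n) \<in> Hardy2"
  by (auto simp: Hardy2_def L2_powi fourier_coeff_powi)

text \<open>
  The limit of the partial sums witnesses the existence that the choice in \<open>P_plus\<close> relies on; testing
  the orthogonality with \<open>z ^ n\<close> gives the Fourier coefficients.
\<close>

lemma P_plus_spec:
  assumes f: "f \<in> L2_circle"
  shows P_plus_Hardy2: "P_plus f \<in> Hardy2"
    and fourier_coeff_P_plus: "n \<ge> 0 \<Longrightarrow> fourier_coeff (P_plus f) n = fourier_coeff f n"
    and L2_inner_P_plus: "h \<in> Hardy2 \<Longrightarrow> L2_inner (P_plus f) h = L2_inner f h"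
proof -
  obtain g where g: "g \<in> Hardy2" "\<And>n. n \<ge> 0 \<Longrightarrow> fourier_coeff g n = fourier_coeff f n"
    using hardy_sum_converges[OF f] by blast
  have "L2_inner (\<lambda>z. f z - g z) h = 0" if "h \<in> Hardy2" for h
    using f g that
    by (intro L2_inner_Hardy2_eq_0 L2_diff) (auto simp: fourier_coeff_diff L2_integrable Hardy2_L2)
  then have "\<exists>g. g \<in> Hardy2 \<and> (\<forall>h\<in>Hardy2. L2_inner (\<lambda>z. f z - g z) h = 0)"
    using g(1) by blast
  then have P: "P_plus f \<in> Hardy2 \<and> (\<forall>h\<in>Hardy2. L2_inner (\<lambda>z. f z - P_plus f z) h = 0)"
    unfolding P_plus_def by (rule someI_ex)
  then show mem: "P_plus f \<in> Hardy2" by blast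
  show inner: "L2_inner (P_plus f) h = L2_inner f h" if "h \<in> Hardy2" for h
    using P that f by (auto simp: L2_inner_diff_left Hardy2_L2)
  show "fourier_coeff (P_plus f) n = fourier_coeff f n" if "n \<ge> 0"
    using inner[OF Hardy2_powi[OF that]] by (simp add: L2_inner_powi)
qed

section \<open>Multiples of a unimodular function\<close>

lemma fourier_coeff_cnj: "fourier_coeff (\<lambda>z. cnj (f z)) n = cnj (fourier_coeff f (- n))"
proof -
  have "cnj (fourier_coeff f (- n)) = (LINT z|circle. cnj (f z * z powi n))"
    by (simp add: fourier_coeff_eq flip: Bochner_Integration.integral_cnj)
  also have "\<dots> = fourier_coeff (\<lambda>z. cnj (f z)) n"
    unfolding fourier_coeff_eq
    by (rule Bochner_Integration.integral_cong) (auto simp: cnj_powi_circle)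
  finally show ?thesis by simp
qed

lemma fourier_coeff_flip:
  assumes "f \<in> borel_measurable circle"
  shows "fourier_coeff (J_flip f) n = fourier_coeff f (- n)"
proof -
  have "fourier_coeff (J_flip f) n = (LINT z|circle. f (cnj z) * cnj z powi n)"
    unfolding fourier_coeff_eq J_flip_def
    by (rule Bochner_Integration.integral_cong) (auto simp: cnj_powi_circle)
  also have "\<dots> = (LINT z|circle. f z * z powi n)"
    by (rule integral_cnj_flip[OF borel_measurable_times[OF assms powi_measurable_circle]])
  finally show ?thesis by (simp add: fourier_coeff_eq)
qed

text \<open>
  This operation conjugates every Fourier coefficient in place.
\<close>

lemma Hardy2_cnj_flip: "h \<in> Hardy2 \<Longrightarrow> (\<lambda>z. cnj (J_flip h z)) \<in> Hardy2"
  by (auto simp: Hardy2_def fourier_coeff_cnj fourier_coeff_flip L2_measurable intro!: L2_cnj L2_flip)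

lemma Linf_cnj_flip: "U \<in> Linf_circle \<Longrightarrow> (\<lambda>z. cnj (J_flip U z)) \<in> Linf_circle"
  unfolding Linf_circle_def J_flip_def
  using measurable_compose[OF measurable_compose[OF cnj_measurable_circle]
      borel_measurable_continuous_onI[OF continuous_on_cnj[OF continuous_on_id]]]
  by (auto dest: AE_cnj_flip)

text \<open>
  A negative Fourier coefficient of \<open>U * h\<close> is the conjugate of the inner product of
  \<open>k = cnj U * z ^ n\<close> with \<open>h\<close>, and for \<open>n < 0\<close> such \<open>k\<close> has only negative frequencies.
\<close>

lemma Hardy2_mult:
  assumes U: "U \<in> Linf_circle" "U \<in> Hardy2" and h: "h \<in> Hardy2"
  shows "(\<lambda>z. U z * h z) \<in> Hardy2"
proof -
  have L2: "(\<lambda>z. U z * h z) \<in> L2_circle"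
    using U h by (intro L2_mult_bounded Hardy2_L2)
  have "fourier_coeff (\<lambda>z. U z * h z) n = 0" if n: "n < 0" for n
  proof -
    define k where "k = (\<lambda>z. cnj (U z) * z powi n)"
    have "k \<in> L2_circle"
      using L2_mult_bounded[OF L2_cnj[OF Hardy2_L2[OF U(2)]] Linf_powi[of n]]
      by (simp add: k_def mult.commute)
    moreover have "fourier_coeff k m = 0" if "m \<ge> 0" for m
      using that n U(2) by (simp add: k_def fourier_coeff_shift fourier_coeff_cnj Hardy2_fourier_coeff_neg)
    ultimately have "L2_inner k h = 0"
      using h by (rule L2_inner_Hardy2_eq_0)
    moreover have "L2_inner k h = (LINT z|circle. cnj (U z * h z * z powi (- n)))"
      unfolding L2_inner_def k_def
      by (rule Bochner_Integration.integral_cong) (auto simp: cnj_powi_circle)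
    ultimately show ?thesis
      by (simp only: Bochner_Integration.integral_cnj fourier_coeff_eq complex_cnj_zero_iff)
  qed
  then show ?thesis using L2 by (simp add: Hardy2_def)
qed

lemma mult_Hardy2_cong_AE:
  assumes "AE z in circle. U z = V z"
  shows "mult_Hardy2 U = mult_Hardy2 V"
proof -
  have "(AE z in circle. f z = U z * h z) \<longleftrightarrow> (AE z in circle. f z = V z * h z)" for f h :: "complex \<Rightarrow> complex"
  proof
    assume "AE z in circle. f z = U z * h z"
    with assms show "AE z in circle. f z = V z * h z" by eventually_elim simp
  next
    assume "AE z in circle. f z = V z * h z"
    with assms show "AE z in circle. f z = U z * h z" by eventually_elim simp
  qed
  then show ?thesis by (simp add: mult_Hardy2_def)
qed

lemma Hardy2_cong_AE:
  assumes "f \<in> L2_circle" "g \<in> Hardy2" "AE z in circle. f z = g z"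
  shows "f \<in> Hardy2"
  using assms L2_eq_AE_iff_fourier_coeff[of f g] by (auto simp: Hardy2_def)

lemma mult_Hardy2_subset_Hardy2:
  assumes "U \<in> Linf_circle" "U \<in> Hardy2"
  shows "mult_Hardy2 U \<subseteq> Hardy2"
  using Hardy2_mult[OF assms] Hardy2_cong_AE by (auto simp: mult_Hardy2_def)

lemma mult_Hardy2_L2: "f \<in> mult_Hardy2 U \<Longrightarrow> f \<in> L2_circle"
  by (simp add: mult_Hardy2_def)

lemma mult_Hardy2_powi:
  assumes f: "f \<in> mult_Hardy2 U" and n: "n \<ge> 0"
  shows "(\<lambda>z. z powi n * f z) \<in> mult_Hardy2 U"
proof -
  obtain h where h: "h \<in> Hardy2" "AE z in circle. f z = U z * h z"
    using f by (auto simp: mult_Hardy2_def)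
  have "(\<lambda>z. z powi n * h z) \<in> Hardy2"
    by (rule Hardy2_mult[OF Linf_powi Hardy2_powi[OF n] h(1)])
  moreover have "AE z in circle. z powi n * f z = U z * (z powi n * h z)"
    using h(2) by eventually_elim simp
  moreover have "(\<lambda>z. z powi n * f z) \<in> L2_circle"
    by (rule L2_mult_bounded[OF mult_Hardy2_L2[OF f] Linf_powi])
  ultimately show ?thesis
    unfolding mult_Hardy2_def by (intro CollectI conjI bexI[of _ "\<lambda>z. z powi n * h z"])
qed

section \<open>Hankel operators\<close>

lemma Hankel_arg_L2: "\<phi> \<in> Linf_circle \<Longrightarrow> f \<in> L2_circle \<Longrightarrow> (\<lambda>z. \<phi> z * J_flip f z) \<in> L2_circle"
  by (intro L2_mult_bounded L2_flip)

text \<open>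
  On the circle \<open>J_flip\<close> turns the factor \<open>z ^ n\<close> into \<open>z ^ (- n)\<close>. Combined with the projection, this
  says that Hankel operators intertwine the shift with the backward shift.
\<close>

lemma fourier_coeff_Hankel_powi:
  "fourier_coeff (\<lambda>z. \<phi> z * J_flip (\<lambda>z. z powi n * f z) z) m = fourier_coeff (\<lambda>z. \<phi> z * J_flip f z) (m + n)"
proof -
  have "fourier_coeff (\<lambda>z. \<phi> z * J_flip (\<lambda>z. z powi n * f z) z) m
      = fourier_coeff (\<lambda>z. (\<phi> z * J_flip f z) * z powi (- n)) m"
    unfolding fourier_coeff_eq J_flip_def
    by (rule Bochner_Integration.integral_cong) (auto simp: cnj_powi_circle)
  then show ?thesis by (simp only: fourier_coeff_shift diff_minus_eq_add)
qed

lemma Hankel_Hardy2: "\<phi> \<in> Linf_circle \<Longrightarrow> f \<in> L2_circle \<Longrightarrow> Hankel \<phi> f \<in> Hardy2"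
  unfolding Hankel_def by (intro P_plus_Hardy2 Hankel_arg_L2)

lemma fourier_coeff_Hankel:
  "\<phi> \<in> Linf_circle \<Longrightarrow> f \<in> L2_circle \<Longrightarrow> n \<ge> 0 \<Longrightarrow>
    fourier_coeff (Hankel \<phi> f) n = fourier_coeff (\<lambda>z. \<phi> z * J_flip f z) n"
  unfolding Hankel_def by (intro fourier_coeff_P_plus Hankel_arg_L2)

lemma Hardy2_0: "(\<lambda>z. 0) \<in> Hardy2"
  by (simp add: Hardy2_def L2_const fourier_coeff_def)

lemma Hankel_AE_zero_iff:
  assumes "\<phi> \<in> Linf_circle" "f \<in> L2_circle"
  shows "(AE z in circle. Hankel \<phi> f z = 0) \<longleftrightarrow> (\<forall>n\<ge>0. fourier_coeff (\<lambda>z. \<phi> z * J_flip f z) n = 0)"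
proof -
  have 0: "fourier_coeff (\<lambda>z. 0) n = 0" for n by (simp add: fourier_coeff_def)
  have "(AE z in circle. Hankel \<phi> f z = 0) \<longleftrightarrow> (\<forall>n. fourier_coeff (Hankel \<phi> f) n = 0)"
    using L2_eq_AE_iff_fourier_coeff[OF Hardy2_L2[OF Hankel_Hardy2[OF assms]] L2_const[of 0]] by (simp add: 0)
  then show ?thesis
    using Hardy2_fourier_coeff_neg[OF Hankel_Hardy2[OF assms]] fourier_coeff_Hankel[OF assms]
    by (metis linorder_not_le)
qed

text \<open>
  If \<open>c = U * h\<close> with \<open>U\<close> unimodular and \<open>c \<noteq> 0\<close>, then \<open>c * cnj U = h\<close> lies in \<open>H\<^sup>2\<close>, so \<open>U\<close> has no positive
  frequencies: for an inner function this means that it is constant.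
\<close>

lemma const_in_mult_Hardy2_imp_coeff_zero:
  assumes U: "U \<in> L2_circle" "AE z in circle. norm (U z) = 1"
    and h: "h \<in> Hardy2" "AE z in circle. c = U z * h z" and c: "c \<noteq> 0" and n: "n > 0"
  shows "fourier_coeff U n = 0"
proof -
  have "AE z in circle. c * cnj (U z) = h z"
    using U(2) h(2)
  proof eventually_elim
    case (elim z)
    then have "c * cnj (U z) = h z * (U z * cnj (U z))" by simp
    also have "U z * cnj (U z) = 1"
      using elim(1) by (simp add: complex_norm_square[symmetric])
    finally show ?case by simp
  qed
  then have "fourier_coeff (\<lambda>z. c * cnj (U z)) (- n) = fourier_coeff h (- n)"
    by (rule fourier_coeff_cong_AE[OF L2_measurable[OF L2_cmult[OF L2_cnj[OF U(1)]]]
          L2_measurable[OF Hardy2_L2[OF h(1)]]])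
  then have "c * cnj (fourier_coeff U n) = 0"
    using n h(1) by (simp add: fourier_coeff_cmult fourier_coeff_cnj Hardy2_fourier_coeff_neg)
  then show ?thesis using c by simp
qed

text \<open>
  Let \<open>g\<close> and \<open>g'\<close> be the images of \<open>f\<close> and of \<open>z * f\<close>. Then \<open>g'\<close> is the backward shift of \<open>g\<close>, that
  is, \<open>g - c = z * g'\<close> with \<open>c\<close> the mean of \<open>g\<close>. By invariance both \<open>g\<close> and \<open>g'\<close> are multiples of \<open>U\<close>,
  hence so is the constant \<open>c\<close>, and a nonconstant \<open>U\<close> only allows \<open>c = 0\<close>.
\<close>

lemma invariant_imp_mean_zero:
  assumes U: "U \<in> L2_circle" "AE z in circle. norm (U z) = 1" "n > 0" "fourier_coeff U n \<noteq> 0"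
    and \<phi>: "\<phi> \<in> Linf_circle"
    and inv: "Hankel \<phi> ` mult_Hardy2 U \<subseteq> mult_Hardy2 U"
    and f: "f \<in> mult_Hardy2 U"
  shows "fourier_coeff (\<lambda>z. \<phi> z * J_flip f z) 0 = 0"
proof (rule ccontr)
  \<comment> \<open>Writing the factor \<open>z\<close> as \<open>z powi 1\<close>, and later 1 as \<open>z powi 0\<close>, makes the rules for \<open>powi\<close> match.\<close>
  define g g' where "g = Hankel \<phi> f" and "g' = Hankel \<phi> (\<lambda>z. z powi 1 * f z)"
  define c where "c = fourier_coeff (\<lambda>z. \<phi> z * J_flip f z) 0"
  assume "fourier_coeff (\<lambda>z. \<phi> z * J_flip f z) 0 \<noteq> 0"
  then have c: "c \<noteq> 0" by (simp add: c_def)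
  have zf: "(\<lambda>z. z powi 1 * f z) \<in> mult_Hardy2 U" using mult_Hardy2_powi[OF f, of 1] by simp
  have gH: "g \<in> Hardy2" "g' \<in> Hardy2"
    unfolding g_def g'_def using mult_Hardy2_L2 f zf by (blast intro: Hankel_Hardy2[OF \<phi>])+
  have cg: "fourier_coeff g n = fourier_coeff (\<lambda>z. \<phi> z * J_flip f z) n" if "n \<ge> 0" for n
    unfolding g_def using that by (rule fourier_coeff_Hankel[OF \<phi> mult_Hardy2_L2[OF f]])
  have cg': "fourier_coeff g' n = fourier_coeff (\<lambda>z. \<phi> z * J_flip f z) (n + 1)" if "n \<ge> 0" for n
    unfolding g'_def using that
    by (simp only: fourier_coeff_Hankel[OF \<phi> mult_Hardy2_L2[OF zf]] fourier_coeff_Hankel_powi)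
  have L2s: "(\<lambda>z. g' z * z powi 1) \<in> L2_circle"
    using L2_mult_bounded[OF Hardy2_L2[OF gH(2)] Linf_powi[of 1]] by (simp add: mult.commute)
  have "AE z in circle. g z - c * z powi 0 = g' z * z powi 1"
  proof (subst L2_eq_AE_iff_fourier_coeff)
    show "(\<lambda>z. g z - c * z powi 0) \<in> L2_circle"
      by (intro L2_diff L2_cmult L2_powi Hardy2_L2 gH)
    show "\<forall>n. fourier_coeff (\<lambda>z. g z - c * z powi 0) n = fourier_coeff (\<lambda>z. g' z * z powi 1) n"
    proof
      fix n :: int
      have "fourier_coeff (\<lambda>z. g z - c * z powi 0) n = fourier_coeff g n - c * (if n = 0 then 1 else 0)"
        using fourier_coeff_diff[OF L2_integrable[OF Hardy2_L2[OF gH(1)]] L2_integrable[OF L2_cmult[OF L2_powi]], of c 0 n]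
        by (simp only: fourier_coeff_cmult fourier_coeff_powi)
      also have "\<dots> = fourier_coeff g' (n - 1)"
      proof -
        consider "n < 0" | "n = 0" | "n > 0" by linarith
        then show ?thesis
          by cases (use gH cg[of n] cg'[of "n - 1"] in \<open>auto simp: Hardy2_fourier_coeff_neg c_def\<close>)
      qed
      finally show "fourier_coeff (\<lambda>z. g z - c * z powi 0) n = fourier_coeff (\<lambda>z. g' z * z powi 1) n"
        by (simp only: fourier_coeff_shift)
    qed
  qed (rule L2s)
  moreover obtain h where h: "h \<in> Hardy2" "AE z in circle. g z = U z * h z"
    using inv f unfolding g_def mult_Hardy2_def by blast
  moreover obtain k where k: "k \<in> Hardy2" "AE z in circle. g' z = U z * k z"
    using inv zf unfolding g'_def mult_Hardy2_def by blast
  ultimately have "AE z in circle. g z - c * z powi 0 = g' z * z powi 1 \<and> g z = U z * h z \<and> g' z = U z * k z"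
    by simp
  then have "AE z in circle. c = U z * (h z - z powi 1 * k z)"
  proof eventually_elim
    case (elim z)
    have eqs: "g z - c = g' z * z" "g z = U z * h z" "g' z = U z * k z"
      using elim unfolding power_int_0_right power_int_1_right mult_1_right by blast+
    have "c = g z - g' z * z" by (simp add: eqs(1)[symmetric])
    also have "\<dots> = U z * h z - U z * k z * z" by (simp only: eqs(2,3))
    finally show ?case by (simp add: algebra_simps)
  qed
  moreover have "(\<lambda>z. h z - z powi 1 * k z) \<in> Hardy2"
  proof -
    have zk: "(\<lambda>z. z powi 1 * k z) \<in> Hardy2"
      using Hardy2_mult[OF Linf_powi Hardy2_powi k(1), of 1] by simp
    have "fourier_coeff (\<lambda>z. h z - z powi 1 * k z) n = 0" if "n < 0" for n
      using fourier_coeff_diff[OF L2_integrable[OF Hardy2_L2[OF h(1)]] L2_integrable[OF Hardy2_L2[OF zk]], of n]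
        Hardy2_fourier_coeff_neg[OF h(1) that] Hardy2_fourier_coeff_neg[OF zk that] by simp
    then show ?thesis using L2_diff[OF Hardy2_L2[OF h(1)] Hardy2_L2[OF zk]] by (simp add: Hardy2_def)
  qed
  ultimately have "fourier_coeff U n = 0"
    using const_in_mult_Hardy2_imp_coeff_zero[OF U(1,2)] c U(3) by blast
  with U(4) show False by contradiction
qed

text \<open>
  Since \<open>U * H\<^sup>2\<close> is stable under multiplication by \<open>z\<close> and this shifts coefficients, vanishing of all
  coefficients of the images is the same as vanishing of their means.
\<close>

lemma mult_Hardy2_subset_ker_iff:
  assumes U: "U \<in> Linf_circle" "U \<in> Hardy2" and \<phi>: "\<phi> \<in> Linf_circle"
  shows "mult_Hardy2 U \<subseteq> ker_Hankel \<phi> \<longleftrightarrow>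
    (\<forall>f\<in>mult_Hardy2 U. fourier_coeff (\<lambda>z. \<phi> z * J_flip f z) 0 = 0)"
proof -
  have "mult_Hardy2 U \<subseteq> ker_Hankel \<phi> \<longleftrightarrow>
      (\<forall>f\<in>mult_Hardy2 U. \<forall>n\<ge>0. fourier_coeff (\<lambda>z. \<phi> z * J_flip f z) n = 0)"
    using mult_Hardy2_subset_Hardy2[OF U] Hankel_AE_zero_iff[OF \<phi> mult_Hardy2_L2]
    unfolding ker_Hankel_def by blast
  also have "\<dots> \<longleftrightarrow> (\<forall>f\<in>mult_Hardy2 U. fourier_coeff (\<lambda>z. \<phi> z * J_flip f z) 0 = 0)"
  proof (intro iffI ballI allI impI)
    fix f n assume *: "\<forall>f\<in>mult_Hardy2 U. fourier_coeff (\<lambda>z. \<phi> z * J_flip f z) 0 = 0"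
      and f: "f \<in> mult_Hardy2 U" and n: "n \<ge> (0::int)"
    show "fourier_coeff (\<lambda>z. \<phi> z * J_flip f z) n = 0"
      using bspec[OF * mult_Hardy2_powi[OF f n]] by (simp only: fourier_coeff_Hankel_powi add_0)
  qed auto
  finally show ?thesis .
qed

lemma invariant_iff_subset_ker:
  assumes U: "U \<in> Linf_circle" "U \<in> Hardy2" "AE z in circle. norm (U z) = 1" "n > 0" "fourier_coeff U n \<noteq> 0"
    and \<phi>: "\<phi> \<in> Linf_circle"
  shows "Hankel \<phi> ` mult_Hardy2 U \<subseteq> mult_Hardy2 U \<longleftrightarrow> mult_Hardy2 U \<subseteq> ker_Hankel \<phi>"
proof
  assume "Hankel \<phi> ` mult_Hardy2 U \<subseteq> mult_Hardy2 U"
  from invariant_imp_mean_zero[OF Hardy2_L2[OF U(2)] U(3-5) \<phi> this]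
  show "mult_Hardy2 U \<subseteq> ker_Hankel \<phi>" unfolding mult_Hardy2_subset_ker_iff[OF U(1,2) \<phi>] by blast
next
  assume ker: "mult_Hardy2 U \<subseteq> ker_Hankel \<phi>"
  show "Hankel \<phi> ` mult_Hardy2 U \<subseteq> mult_Hardy2 U"
  proof safe
    fix f assume f: "f \<in> mult_Hardy2 U"
    then have "AE z in circle. Hankel \<phi> f z = 0" using ker by (auto simp: ker_Hankel_def)
    then have "AE z in circle. Hankel \<phi> f z = U z * 0" by simp
    then show "Hankel \<phi> f \<in> mult_Hardy2 U"
      using Hardy2_L2[OF Hankel_Hardy2[OF \<phi> mult_Hardy2_L2[OF f]]] Hardy2_0
      unfolding mult_Hardy2_def by (intro CollectI conjI bexI[of _ "\<lambda>z. 0"])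
  qed
qed

text \<open>
  The involution \<open>S h = cnj (J_flip h)\<close> is multiplicative and preserves \<open>H\<^sup>2\<close>, so it carries \<open>U * H\<^sup>2\<close>
  onto \<open>V * H\<^sup>2\<close> with \<open>V = S U\<close>. The mean of \<open>\<phi> * J_flip f\<close> is the inner product of \<open>\<phi>\<close> with \<open>S f\<close>,
  which is also that of \<open>P_plus \<phi>\<close> with \<open>S f\<close> when \<open>S f\<close> lies in \<open>H\<^sup>2\<close>.
\<close>

lemma subset_ker_iff_model_space:
  assumes U: "U \<in> Linf_circle" "U \<in> Hardy2" and \<phi>: "\<phi> \<in> Linf_circle"
  shows "mult_Hardy2 U \<subseteq> ker_Hankel \<phi> \<longleftrightarrow> P_plus \<phi> \<in> model_space (\<lambda>z. cnj (J_flip U z))"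
proof -
  define V where "V = (\<lambda>z. cnj (J_flip U z))"
  have V: "V \<in> Linf_circle" "V \<in> Hardy2"
    unfolding V_def using U by (auto intro: Linf_cnj_flip Hardy2_cnj_flip)
  have \<phi>2: "\<phi> \<in> L2_circle" using \<phi> by (rule Linf_subset_L2)
  define S where "S = (\<lambda>h z. cnj (J_flip h z))"
  have SS: "S (S h) = h" for h by (simp add: S_def J_flip_def)
  have mem: "S f \<in> mult_Hardy2 V" if f: "f \<in> mult_Hardy2 U" and "V = S U" for f U V
  proof -
    obtain h where h: "h \<in> Hardy2" "AE z in circle. f z = U z * h z"
      using f by (auto simp: mult_Hardy2_def)
    have "AE z in circle. S f z = V z * S h z"
      using AE_cnj_flip[OF h(2)] by eventually_elim (simp add: \<open>V = S U\<close> S_def J_flip_def)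
    moreover have "S h \<in> Hardy2" unfolding S_def using h(1) by (rule Hardy2_cnj_flip)
    moreover have "S f \<in> L2_circle" unfolding S_def by (intro L2_cnj L2_flip mult_Hardy2_L2[OF f])
    ultimately show ?thesis by (auto simp: mult_Hardy2_def)
  qed
  have VS: "V = S U" "U = S V" by (simp_all add: V_def S_def J_flip_def)
  have image: "mult_Hardy2 V = S ` mult_Hardy2 U"
  proof (intro equalityI subsetI)
    fix g assume "g \<in> mult_Hardy2 V"
    then have "S g \<in> mult_Hardy2 U" by (rule mem[OF _ VS(2)])
    then show "g \<in> S ` mult_Hardy2 U" by (intro image_eqI[of g S "S g"]) (simp_all only: SS)
  qed (use mem[OF _ VS(1)] in blast)
  have inner: "L2_inner \<phi> (S f) = fourier_coeff (\<lambda>z. \<phi> z * J_flip f z) 0" for f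
    by (simp add: L2_inner_def fourier_coeff_def S_def)
  have "P_plus \<phi> \<in> model_space V \<longleftrightarrow> (\<forall>g\<in>mult_Hardy2 V. L2_inner (P_plus \<phi>) g = 0)"
    using P_plus_Hardy2[OF \<phi>2] by (simp add: model_space_def)
  also have "\<dots> \<longleftrightarrow> (\<forall>g\<in>mult_Hardy2 V. L2_inner \<phi> g = 0)"
    using mult_Hardy2_subset_Hardy2[OF V] L2_inner_P_plus[OF \<phi>2] by (metis subsetD)
  also have "\<dots> \<longleftrightarrow> (\<forall>f\<in>mult_Hardy2 U. fourier_coeff (\<lambda>z. \<phi> z * J_flip f z) 0 = 0)"
    by (simp add: image inner)
  also have "\<dots> \<longleftrightarrow> mult_Hardy2 U \<subseteq> ker_Hankel \<phi>"
    using mult_Hardy2_subset_ker_iff[OF U \<phi>] by simp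
  finally show ?thesis by (simp add: V_def)
qed

section \<open>Boundary values of inner functions\<close>

text \<open>
  The power series converges on the circle of radius \<open>r\<close> dominated by the convergent series of
  \<open>norm (a k) * r ^ k\<close>, so it can be integrated term by term.
\<close>

lemma fourier_coeff_dilation:
  assumes u: "u holomorphic_on ball 0 1" and r: "0 < r" "r < 1"
  shows "fourier_coeff (\<lambda>z. u (of_real r * z)) n
    = (if n \<ge> 0 then (deriv ^^ nat n) u 0 / fact (nat n) * of_real r ^ nat n else 0)"
proof -
  define a where "a k = (deriv ^^ k) u 0 / fact k" for k
  have sums: "(\<lambda>k. a k * w ^ k) sums u w" if "norm w < 1" for w
    using holomorphic_power_series[OF u, of w] that by (simp add: a_def)
  obtain \<rho> where \<rho>: "r < \<rho>" "\<rho> < 1" using dense r(2) by blast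
  have abs: "summable (\<lambda>k. norm (a k) * r ^ k)"
  proof -
    have "summable (\<lambda>k. a k * of_real \<rho> ^ k)"
      using sums[of "of_real \<rho>"] r \<rho> by (auto simp: sums_iff)
    from powser_insidea[OF this, of "of_real r"] show ?thesis
      using r \<rho> by (simp add: norm_mult norm_power)
  qed
  define s where "s N = (\<lambda>z. \<Sum>k\<in>int ` {..<N}. (a (nat k) * of_real r ^ nat k) * z powi k)" for N
  have s_eq: "s N z = (\<Sum>k<N. a k * (of_real r * z) ^ k)" for N z
    by (simp add: s_def sum.reindex power_mult_distrib mult.assoc)
  have sL2: "s N \<in> L2_circle" for N unfolding s_def by (intro L2_sum L2_cmult L2_powi)
  note [measurable] = L2_measurable[OF sL2]
  have cont: "continuous_on (sphere 0 1) (\<lambda>z. u (of_real r * z))"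
    by (rule continuous_on_compose2[OF holomorphic_on_imp_continuous_on[OF u]])
       (use r in \<open>auto intro!: continuous_intros simp: norm_mult\<close>)
  note [measurable] = continuous_measurable_circle[OF cont]
  have "(\<lambda>N. LINT z|circle. s N z * z powi (- n)) \<longlonglongrightarrow> (LINT z|circle. u (of_real r * z) * z powi (- n))"
  proof (rule integral_dominated_convergence)
    show "integrable circle (\<lambda>z. \<Sum>k. norm (a k) * r ^ k)" by simp
    show "AE z in circle. (\<lambda>N. s N z * z powi (- n)) \<longlonglongrightarrow> u (of_real r * z) * z powi (- n)"
    proof (rule AE_circleI)
      fix z :: complex assume "norm z = 1"
      then have "(\<lambda>k. a k * (of_real r * z) ^ k) sums u (of_real r * z)"
        using r by (intro sums) (simp add: norm_mult)
      then show "(\<lambda>N. s N z * z powi (- n)) \<longlonglongrightarrow> u (of_real r * z) * z powi (- n)"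
        unfolding sums_def s_eq by (intro tendsto_intros)
    qed
    show "AE z in circle. norm (s N z * z powi (- n)) \<le> (\<Sum>k. norm (a k) * r ^ k)" for N
    proof (rule AE_circleI)
      fix z :: complex assume z: "norm z = 1"
      have "norm (s N z * z powi (- n)) = norm (s N z)" using z by (simp add: norm_mult norm_power_int)
      also have "\<dots> \<le> (\<Sum>k<N. norm (a k) * r ^ k)"
        unfolding s_eq by (rule sum_norm_le) (use r z in \<open>simp add: norm_mult norm_power\<close>)
      also have "\<dots> \<le> (\<Sum>k. norm (a k) * r ^ k)"
        using abs r by (intro sum_le_suminf) auto
      finally show "norm (s N z * z powi (- n)) \<le> (\<Sum>k. norm (a k) * r ^ k)" .
    qed
  qed measurable
  then have lim: "(\<lambda>N. fourier_coeff (s N) n) \<longlonglongrightarrow> fourier_coeff (\<lambda>z. u (of_real r * z)) n"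
    by (simp only: fourier_coeff_eq)
  have cs: "fourier_coeff (s N) n = (if n \<in> int ` {..<N} then a (nat n) * of_real r ^ nat n else 0)" for N
    unfolding s_def by (rule fourier_coeff_trig_sum) simp
  have "\<forall>\<^sub>F N in sequentially. fourier_coeff (s N) n = (if n \<ge> 0 then a (nat n) * of_real r ^ nat n else 0)"
    using eventually_gt_at_top[of "nat n"]
  proof eventually_elim
    case (elim N)
    then have "n \<in> int ` {..<N} \<longleftrightarrow> n \<ge> 0" by (auto intro!: image_eqI[of _ _ "nat n"])
    then show ?case by (simp add: cs)
  qed
  from LIMSEQ_unique[OF lim tendsto_eventually[OF this]] show ?thesis by (simp add: a_def)
qed

text \<open>
  \<open>U\<close> is the limit along a sequence of radii: it is measurable as a sequential limit, whereas the
  limit over all radii involves an uncountable family and unspecified values. Fourier coefficients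
  pass to the limit because \<open>u\<close> is bounded.
\<close>

lemma inner_function_boundary_values:
  assumes u: "inner_function u"
  obtains U where "U \<in> Linf_circle" "U \<in> Hardy2" "AE z in circle. radial_limit u z = U z"
    "AE z in circle. norm (U z) = 1"
    "\<And>k. fourier_coeff U (int k) = (deriv ^^ k) u 0 / fact k"
proof -
  have hol: "u holomorphic_on ball 0 1" and bdd: "bounded (u ` ball 0 1)"
    using u by (auto simp: inner_function_def Hinf_disc_def)
  have AE: "AE z in circle. ((\<lambda>r. u (of_real r * z)) \<longlongrightarrow> radial_limit u z) (at_left (1::real))
        \<and> norm (radial_limit u z) = 1"
    using u by (simp add: inner_function_def)
  obtain M where M: "\<And>w. norm w < 1 \<Longrightarrow> norm (u w) \<le> M"
    using bdd unfolding bounded_iff by (metis image_eqI mem_ball_0)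
  define r where "r k = 1 - 1 / real (k + 2)" for k
  have r: "0 < r k" "r k < 1" for k by (auto simp: r_def field_simps)
  have rlim: "r \<longlonglongrightarrow> 1"
    unfolding r_def by real_asymp
  have rleft: "filterlim r (at_left 1) sequentially"
    using rlim less_imp_neq[OF r(2)] r(2) by (auto simp: filterlim_at intro!: always_eventually)
  define U where "U z = lim (\<lambda>k. u (of_real (r k) * z))" for z
  have cont: "continuous_on (sphere 0 1) (\<lambda>z. u (of_real (r k) * z))" for k
    by (rule continuous_on_compose2[OF holomorphic_on_imp_continuous_on[OF hol]])
       (use r[of k] in \<open>auto intro!: continuous_intros simp: norm_mult\<close>)
  note [measurable] = continuous_measurable_circle[OF cont]
  have Um[measurable]: "U \<in> borel_measurable circle" unfolding U_def by measurable
  have conv: "AE z in circle. (\<lambda>k. u (of_real (r k) * z)) \<longlonglongrightarrow> radial_limit u z"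
    using AE by eventually_elim (auto intro: filterlim_compose[OF _ rleft])
  then have eq: "AE z in circle. radial_limit u z = U z"
    by eventually_elim (simp add: U_def limI)
  then have norm: "AE z in circle. norm (U z) = 1"
    using AE by eventually_elim simp
  have Linf: "U \<in> Linf_circle"
    unfolding Linf_circle_def using Um norm by (auto intro!: exI[of _ 1] elim: eventually_mono)
  have "(\<lambda>k. LINT z|circle. u (of_real (r k) * z) * z powi (- n)) \<longlonglongrightarrow> (LINT z|circle. U z * z powi (- n))" for n
  proof (rule integral_dominated_convergence)
    show "integrable circle (\<lambda>z. M)" by simp
    show "AE z in circle. (\<lambda>k. u (of_real (r k) * z) * z powi (- n)) \<longlonglongrightarrow> U z * z powi (- n)"
      using conv eq by eventually_elim (intro tendsto_intros, simp)
    show "AE z in circle. norm (u (of_real (r k) * z) * z powi (- n)) \<le> M" for k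
      using r[of k] by (intro AE_circleI) (simp add: norm_mult norm_power_int M)
  qed measurable
  then have lim: "(\<lambda>k. fourier_coeff (\<lambda>z. u (of_real (r k) * z)) n) \<longlonglongrightarrow> fourier_coeff U n" for n
    by (simp only: fourier_coeff_eq)
  have "fourier_coeff U n = (if n \<ge> 0 then (deriv ^^ nat n) u 0 / fact (nat n) * of_real 1 ^ nat n else 0)" for n
  proof (rule LIMSEQ_unique[OF lim])
    show "(\<lambda>k. fourier_coeff (\<lambda>z. u (of_real (r k) * z)) n) \<longlonglongrightarrow>
        (if n \<ge> 0 then (deriv ^^ nat n) u 0 / fact (nat n) * of_real 1 ^ nat n else 0)"
    proof (cases "n \<ge> 0")
      case True
      show ?thesis
        unfolding fourier_coeff_dilation[OF hol r] using True
        by (simp only: if_True) (intro tendsto_intros rlim)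
    qed (simp add: fourier_coeff_dilation[OF hol r])
  qed
  then have "U \<in> Hardy2" "\<And>k. fourier_coeff U (int k) = (deriv ^^ k) u 0 / fact k"
    using Linf by (auto simp: Hardy2_def Linf_subset_L2)
  with Linf eq norm show ?thesis by (intro that)
qed

section \<open>Invariance, kernel and model space\<close>

theorem theorem1p5:
  fixes u \<phi> :: "complex \<Rightarrow> complex"
  assumes "inner_function u"
    and "\<not> u constant_on ball 0 1"
    and "\<phi> \<in> Linf_circle"
  shows "(Hankel \<phi> ` mult_Hardy2 (radial_limit u) \<subseteq> mult_Hardy2 (radial_limit u)
            \<longleftrightarrow> mult_Hardy2 (radial_limit u) \<subseteq> ker_Hankel \<phi>)
       \<and> (mult_Hardy2 (radial_limit u) \<subseteq> ker_Hankel \<phi>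
            \<longleftrightarrow> P_plus \<phi> \<in> model_space (\<lambda>z. cnj (J_flip (radial_limit u) z)))"
proof -
  obtain U where U: "U \<in> Linf_circle" "U \<in> Hardy2" "AE z in circle. radial_limit u z = U z"
    "AE z in circle. norm (U z) = 1"
    and coeff: "\<And>k. fourier_coeff U (int k) = (deriv ^^ k) u 0 / fact k"
    using inner_function_boundary_values[OF assms(1)] by blast
  \<comment> \<open>Otherwise the Taylor series of \<open>u\<close> at 0 reduces to its constant term.\<close>
  have "\<exists>k>0. fourier_coeff U (int k) \<noteq> 0"
  proof (rule ccontr)
    assume "\<not> ?thesis"
    then have "\<And>k. k > 0 \<Longrightarrow> (deriv ^^ k) u 0 / fact k = 0" by (metis coeff)
    then have zero: "(deriv ^^ k) u 0 / fact k * w ^ k = (if k = 0 then u 0 else 0)" for k w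
      by (cases "k = 0") auto
    have hol: "u holomorphic_on ball 0 1"
      using assms(1) by (simp add: inner_function_def Hinf_disc_def)
    have "u w = u 0" if "w \<in> ball 0 1" for w
    proof -
      have "(\<lambda>k. if k = 0 then u 0 else 0) sums u w"
        using holomorphic_power_series[OF hol that] by (simp only: diff_zero zero)
      then show ?thesis using sums_single[of 0 "\<lambda>_. u 0"] sums_unique2 by blast
    qed
    then show False using assms(2) unfolding constant_on_def by blast
  qed
  then obtain k where k: "k > 0" "fourier_coeff U (int k) \<noteq> 0" by blast
  have flip: "AE z in circle. cnj (J_flip (radial_limit u) z) = cnj (J_flip U z)"
    using AE_cnj_flip[OF U(3)] by eventually_elim (simp add: J_flip_def)
  show ?thesis
    using invariant_iff_subset_ker[OF U(1,2,4) _ k(2) assms(3)] k(1)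
      subset_ker_iff_model_space[OF U(1,2) assms(3)]
    by (simp add: mult_Hardy2_cong_AE[OF U(3)] model_space_def mult_Hardy2_cong_AE[OF flip])
qed

end
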